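(* Let $p\geq 2$ be an integer (not necessarily prime), let $k\geq 1$ and $0\leq s<p$ be integers, and consider the level $k+1$ weight $\Lambda=k\Lambda_0+\Lambda_s$ of $\widehat{\mathfrak{sl}}_p=\mathfrak{g}(A^{(1)}_{p-1})$. Then, for every integer $\ell$ with $1\leq \ell\leq \lfloor\frac{p-s}{2}\rfloor$, the multiplicity $\dim V(\Lambda)_{\Lambda-\lambda^p_{\ell,s}}$ is equal to the number of shuffles of $0^s,1,2,\dots,\ell$ (there are $s$ zeroes) that have no strictly decreasing subsequence of length $k+2$.
   Context: $\mathfrak{g}(A^{(1)}_{p-1})$ is the affine Kac-Moody Lie algebra with generalized Cartan matrix $A^{(1)}_{p-1}=(2\delta_{ij}-\delta_{i+1,j}-\delta_{i-1,j})_{i,j\in\mathbb{Z}/p\mathbb{Z}}$ (so for $p=2$ the off-diagonal entries are $-2$); the index set $\mathbb{Z}/p\mathbb{Z}$ is identified with $\{0,1,\dots,p-1\}$. The simple roots are $\alpha_i$, the fundamental weights are $\Lambda_i$. For a dominant integral weight $\Lambda$, $V(\Lambda)$ is the integrable irreducible highest weight module with highest weight $\Lambda$, and $V(\Lambda)_\mu$ is its $\mu$-weight space. For $\ell\geq 1$ and $t\geq 0$ with $\ell+t<p-\ell+1$, the element $\lambda^p_{\ell,t}$ of the root lattice is $$\lambda^p_{\ell,t}=\ell\alpha_0+\bigl(\ell\alpha_1+\cdots+\ell\alpha_t\bigr)+\bigl((\ell-1)\alpha_{t+1}+(\ell-2)\alpha_{t+2}+\cdots+\alpha_{\ell+t-1}\bigr)+\bigl(\alpha_{p-\ell+1}+\cdots+(\ell-2)\alpha_{p-2}+(\ell-1)\alpha_{p-1}\bigr).$$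 A shuffle of $0^s,1,2,\dots,\ell$ is a word $w_1w_2\cdots w_{\ell+s}$ which is a rearrangement of the multiset consisting of $s$ copies of $0$ and one copy of each of $1,2,\dots,\ell$. A strictly decreasing subsequence of length $m$ is given by positions $i_1<\cdots<i_m$ with $w_{i_1}>\cdots>w_{i_m}$. *)

theory Defs
  imports "HOL-Library.Sublist" "HOL-Library.Multiset" "Jordan_Normal_Form.DL_Rank"
begin

locale lie_algebra = vector_space scale
  for scale :: "complex \<Rightarrow> 'g::ab_group_add \<Rightarrow> 'g" +
  fixes bracket :: "'g \<Rightarrow> 'g \<Rightarrow> 'g"
  assumes bracket_linear_right: "Vector_Spaces.linear scale scale (\<lambda>y. bracket x y)"
    and bracket_linear_left: "Vector_Spaces.linear scale scale (\<lambda>x. bracket x y)"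
    and bracket_self: "bracket x x = 0"
    and jacobi: "bracket x (bracket y z) + bracket y (bracket z x) + bracket z (bracket x y) = 0"
begin

definition subalgebra :: "'g set \<Rightarrow> bool" where
  "subalgebra S \<longleftrightarrow> subspace S \<and> (\<forall>x\<in>S. \<forall>y\<in>S. bracket x y \<in> S)"

definition lie_ideal :: "'g set \<Rightarrow> bool" where
  "lie_ideal I \<longleftrightarrow> subspace I \<and> (\<forall>x. \<forall>y\<in>I. bracket x y \<in> I)"

end

locale lie_module = lie_algebra scale bracket + V: vector_space vscale
  for scale :: "complex \<Rightarrow> 'g::ab_group_add \<Rightarrow> 'g"
    and bracket :: "'g \<Rightarrow> 'g \<Rightarrow> 'g"
    and vscale :: "complex \<Rightarrow> 'v::ab_group_add \<Rightarrow> 'v" +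
  fixes act :: "'g \<Rightarrow> 'v \<Rightarrow> 'v"
  assumes act_linear_vector: "Vector_Spaces.linear vscale vscale (\<lambda>v. act x v)"
    and act_linear_algebra: "Vector_Spaces.linear scale vscale (\<lambda>x. act x v)"
    and act_bracket: "act (bracket x y) v = act x (act y v) - act y (act x v)"
begin

definition submodule :: "'v set \<Rightarrow> bool" where
  "submodule W \<longleftrightarrow> V.subspace W \<and> (\<forall>x. \<forall>w\<in>W. act x w \<in> W)"

definition irreducible_module :: bool where
  "irreducible_module \<longleftrightarrow> (\<exists>v::'v. v \<noteq> 0) \<and> (\<forall>W. submodule W \<longrightarrow> W = {0} \<or> W = UNIV)"

definition locally_nilpotent :: "'g \<Rightarrow> bool" where
  "locally_nilpotent x \<longleftrightarrow> (\<forall>v. \<exists>N. (act x ^^ N) v = 0)"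

end

text \<open>
  The locale says that the Lie algebra on \<open>'g\<close> is a copy of \<open>\<gg>(A)\<close>, with Cartan subalgebra \<open>h\<close>,
  Chevalley generators \<open>e i\<close>, \<open>f i\<close>, simple coroots \<open>coroot i\<close> and simple roots \<open>root i\<close>
  (\<open>i < n\<close>), following Kac: \<open>(h, root, coroot)\<close> is a realization of \<open>A\<close>; the relations
  together with \<open>generated\<close> make \<open>\<gg>\<close> a quotient of the auxiliary algebra \<open>\<gg>~(A)\<close> in which \<open>h\<close>
  embeds; and \<open>no_ideal\<close> says that the kernel is the largest ideal of \<open>\<gg>~(A)\<close> meeting \<open>h\<close>
  trivially.

  Elements of the dual of \<open>h\<close> are represented by functions on \<open>'g\<close> of which only the restriction
  to \<open>h\<close> matters.
\<close>

definition gcm_rank :: "nat \<Rightarrow> (nat \<Rightarrow> nat \<Rightarrow> int) \<Rightarrow> nat" where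
  "gcm_rank n A = vec_space.rank n (mat n n (\<lambda>(i, j). complex_of_int (A i j)))"

locale kac_moody_algebra = lie_algebra scale bracket
  for scale :: "complex \<Rightarrow> 'g::ab_group_add \<Rightarrow> 'g"
    and bracket :: "'g \<Rightarrow> 'g \<Rightarrow> 'g" +
  fixes n :: nat
    and A :: "nat \<Rightarrow> nat \<Rightarrow> int"
    and h :: "'g set"
    and coroot :: "nat \<Rightarrow> 'g"
    and root :: "nat \<Rightarrow> 'g \<Rightarrow> complex"
    and e f :: "nat \<Rightarrow> 'g"
  assumes h_subspace: "subspace h"
    and h_finite_dim: "\<exists>B. finite B \<and> span B = h"
    and h_dim: "dim h = 2 * n - gcm_rank n A"
    and coroot_in_h: "i < n \<Longrightarrow> coroot i \<in> h"
    and coroot_independent: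
      "(\<Sum>i<n. scale (c i) (coroot i)) = 0 \<Longrightarrow> i < n \<Longrightarrow> c i = 0"
    and root_add: "i < n \<Longrightarrow> x \<in> h \<Longrightarrow> y \<in> h \<Longrightarrow> root i (x + y) = root i x + root i y"
    and root_scale: "i < n \<Longrightarrow> x \<in> h \<Longrightarrow> root i (scale a x) = a * root i x"
    and root_independent:
      "(\<And>x. x \<in> h \<Longrightarrow> (\<Sum>i<n. c i * root i x) = 0) \<Longrightarrow> i < n \<Longrightarrow> c i = 0"
    and root_coroot: "i < n \<Longrightarrow> j < n \<Longrightarrow> root j (coroot i) = complex_of_int (A i j)"
    and bracket_e_f:
      "i < n \<Longrightarrow> j < n \<Longrightarrow> bracket (e i) (f j) = (if i = j then coroot i else 0)"
    and bracket_h_h: "x \<in> h \<Longrightarrow> y \<in> h \<Longrightarrow> bracket x y = 0"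
    and bracket_h_e: "x \<in> h \<Longrightarrow> i < n \<Longrightarrow> bracket x (e i) = scale (root i x) (e i)"
    and bracket_h_f: "x \<in> h \<Longrightarrow> i < n \<Longrightarrow> bracket x (f i) = scale (- root i x) (f i)"
    and generated: "subalgebra hull (h \<union> e ` {..<n} \<union> f ` {..<n}) = UNIV"
    and no_ideal: "lie_ideal I \<Longrightarrow> I \<inter> h = {0} \<Longrightarrow> I = {0}"
begin

definition n_plus :: "'g set" where
  "n_plus = subalgebra hull (e ` {..<n})"

definition h_dual :: "('g \<Rightarrow> complex) set" where
  "h_dual = {\<phi>. (\<forall>x\<in>h. \<forall>y\<in>h. \<phi> (x + y) = \<phi> x + \<phi> y)
                \<and> (\<forall>a. \<forall>x\<in>h. \<phi> (scale a x) = a * \<phi> x)}"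

text \<open>
  Fundamental weights are only determined up to functionals vanishing on all the coroots (for
  affine \<open>A\<close>: up to multiples of the null root), so this is a predicate: any choice is allowed.
\<close>
definition fundamental_weights :: "(nat \<Rightarrow> 'g \<Rightarrow> complex) \<Rightarrow> bool" where
  "fundamental_weights \<omega> \<longleftrightarrow>
     (\<forall>i<n. \<omega> i \<in> h_dual \<and> (\<forall>j<n. \<omega> i (coroot j) = (if i = j then 1 else 0)))"

end

locale kac_moody_module =
  kac_moody_algebra scale bracket n A h coroot root e f + lie_module scale bracket vscale act
  for scale :: "complex \<Rightarrow> 'g::ab_group_add \<Rightarrow> 'g"
    and bracket :: "'g \<Rightarrow> 'g \<Rightarrow> 'g"
    and n :: nat
    and A :: "nat \<Rightarrow> nat \<Rightarrow> int"
    and h :: "'g set"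
    and coroot :: "nat \<Rightarrow> 'g"
    and root :: "nat \<Rightarrow> 'g \<Rightarrow> complex"
    and e f :: "nat \<Rightarrow> 'g"
    and vscale :: "complex \<Rightarrow> 'v::ab_group_add \<Rightarrow> 'v"
    and act :: "'g \<Rightarrow> 'v \<Rightarrow> 'v"
begin

definition weight_space :: "('g \<Rightarrow> complex) \<Rightarrow> 'v set" where
  "weight_space \<mu> = {v. \<forall>x\<in>h. act x v = vscale (\<mu> x) v}"

definition multiplicity :: "('g \<Rightarrow> complex) \<Rightarrow> nat" where
  "multiplicity \<mu> = V.dim (weight_space \<mu>)"

definition highest_weight_module :: "('g \<Rightarrow> complex) \<Rightarrow> bool" where
  "highest_weight_module \<Lambda> \<longleftrightarrow> \<Lambda> \<in> h_dual \<and>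
     (\<exists>v. v \<noteq> 0 \<and> (\<forall>x\<in>n_plus. act x v = 0) \<and> v \<in> weight_space \<Lambda> \<and> submodule hull {v} = UNIV)"

text \<open>The sum of weight spaces in the first conjunct is automatically direct.\<close>
definition integrable_module :: bool where
  "integrable_module \<longleftrightarrow>
     V.span (\<Union>\<mu>\<in>h_dual. weight_space \<mu>) = UNIV
     \<and> (\<forall>i<n. locally_nilpotent (e i) \<and> locally_nilpotent (f i))"

definition is_integrable_irreducible_hw :: "('g \<Rightarrow> complex) \<Rightarrow> bool" where
  "is_integrable_irreducible_hw \<Lambda> \<longleftrightarrow>
     integrable_module \<and> irreducible_module \<and> highest_weight_module \<Lambda>"

end

text \<open>The matrix on \<open>{0..<p}\<close>; for \<open>p = 2\<close> both subtracted terms occur off the diagonal.\<close>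
definition affine_A :: "nat \<Rightarrow> nat \<Rightarrow> nat \<Rightarrow> int" where
  "affine_A p i j =
     2 * of_bool (i = j) - of_bool ((i + 1) mod p = j) - of_bool ((j + 1) mod p = i)"

definition lambda_elt ::
  "nat \<Rightarrow> nat \<Rightarrow> nat \<Rightarrow> (nat \<Rightarrow> 'g \<Rightarrow> complex) \<Rightarrow> 'g \<Rightarrow> complex" where
  "lambda_elt p l t \<alpha> x =
     of_nat l * \<alpha> 0 x
     + (\<Sum>i = 1..t. of_nat l * \<alpha> i x)
     + (\<Sum>j = 1..<l. of_nat (l - j) * \<alpha> (t + j) x)
     + (\<Sum>j = 1..<l. of_nat (l - j) * \<alpha> (p - j) x)"

definition shuffles_of :: "nat \<Rightarrow> nat \<Rightarrow> nat list set" where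
  "shuffles_of s l = {w. mset w = replicate_mset s 0 + mset [1..<l + 1]}"

definition has_decreasing_subseq :: "nat \<Rightarrow> nat list \<Rightarrow> bool" where
  "has_decreasing_subseq m w \<longleftrightarrow> (\<exists>u. subseq u w \<and> length u = m \<and> sorted_wrt (>) u)"

end

theory Submission
  imports Defs "HOL-Library.List_Lexorder" "HOL-Library.Function_Algebras"
    "HOL-Combinatorics.Permutations"
begin

text \<open>
  Let \<open>n = 2l + s\<close>. The simple roots occurring in the weight form a chain of \<open>n - 1\<close> vertices of
  the Dynkin diagram, so that the weight space only sees a copy of \<open>sl n\<close>: it is a weight space
  of the irreducible \<open>gl n\<close>-module with highest weight \<open>((k + 1)^l, 1^s, 0^l)\<close>, for the weight
  \<open>(k^l, 1^(l + s))\<close>. This module is realized inside a fermionic Fock space whose modes are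
  arranged in \<open>n\<close> rows and \<open>k + 1\<close> columns. The operator \<open>E b a\<close> moves a particle from row \<open>a\<close> to
  row \<open>b\<close> within its column, and the highest weight vector has the first \<open>l\<close> rows full and one
  particle, in column \<open>0\<close>, in each of the next \<open>s\<close> rows.

  The two sides are compared by the relation \<open>paired\<close>, generated by the pair of the two highest
  weight vectors under linear combinations and simultaneous lowering. It is stable under raising,
  because the commutation relations agree on both sides, and so it respects the coefficient of the highest weight vector. Irreducibility on one side
  (\<open>paired_zero_right\<close>) and the positive definite hermitian form on the other
  (\<open>paired_zero_left\<close>) make it the graph of a bijection. The multiplicity is thus the dimension of
  the part of the Fock space that is reached by lowering with the right row occupancies.

  That part is spanned by one vector for each shuffle \<open>w\<close>: a letter \<open>x \<ge> 1\<close> at position \<open>q\<close> moves a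
  particle from row \<open>x - 1\<close> to row \<open>l + q\<close>, and a letter \<open>0\<close> there places a particle in column
  \<open>0\<close> of row \<open>l + q\<close> (\<open>word_vec_target\<close>, \<open>reach_shuffle\<close>). Choosing the column of each moved
  particle amounts to colouring the letters by columns, where \<open>0\<close> has the colour \<open>0\<close>. Up to a
  nonzero factor depending on \<open>w\<close> alone the vector is the sum over all colourings \<open>a\<close> of plus or minus the
  configuration determined by \<open>a\<close> and the coloured word \<open>a \<circ> w\<close>, with a sign depending on \<open>a\<close>
  alone (\<open>word_vec_eq_conf_sum\<close>). What remains is the combinatorics of permutations acting on
  tensors over a space of dimension \<open>k + 1\<close>.

  \<^item> If \<open>k + 2\<close> letters of \<open>w\<close> are decreasing, then in every colouring two of them have the same
    colour, and the alternating sum over all rearrangements of these letters vanishes. All other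
    rearrangements are lexicographically smaller than \<open>w\<close>, so the words without such letters
    suffice to span (\<open>colour_sum_in_span_avoiders\<close>).
  \<^item> If there are no such letters, then colouring each letter by the length of the longest
    decreasing subsequence starting there uses \<open>k + 1\<close> colours and makes letters of equal colour
    weakly increasing. Hence \<open>w\<close> is the lexicographically least word with its coloured pattern.
    The coefficients of the vectors in these patterns form a triangular matrix, and the vectors
    are linearly independent (\<open>avoiders_independent\<close>).
\<close>

section \<open>Words without long decreasing subsequences\<close>

definition decreasing_at :: "nat list \<Rightarrow> nat set \<Rightarrow> bool" where
  "decreasing_at w D \<longleftrightarrow> D \<subseteq> {..<length w} \<and> (\<forall>i\<in>D. \<forall>j\<in>D. i < j \<longrightarrow> w ! j < w ! i)"

lemma sorted_wrt_nths_iff: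
  "sorted_wrt R (nths w N) \<longleftrightarrow> (\<forall>i\<in>N. \<forall>j\<in>N. i < j \<longrightarrow> j < length w \<longrightarrow> R (w ! i) (w ! j))"
proof (induction w arbitrary: N)
  case Nil
  then show ?case by simp
next
  case (Cons x w)
  have IH: "sorted_wrt R (nths w {j. Suc j \<in> N}) \<longleftrightarrow>
      (\<forall>i j. Suc i \<in> N \<longrightarrow> Suc j \<in> N \<longrightarrow> i < j \<longrightarrow> j < length w \<longrightarrow> R (w ! i) (w ! j))"
    using Cons.IH by auto
  have split: "(\<forall>i\<in>N. \<forall>j\<in>N. i < j \<longrightarrow> j < length (x # w) \<longrightarrow> R ((x # w) ! i) ((x # w) ! j)) \<longleftrightarrow>
      (0 \<in> N \<longrightarrow> (\<forall>j. Suc j \<in> N \<longrightarrow> j < length w \<longrightarrow> R x (w ! j))) \<and>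
      (\<forall>i j. Suc i \<in> N \<longrightarrow> Suc j \<in> N \<longrightarrow> i < j \<longrightarrow> j < length w \<longrightarrow> R (w ! i) (w ! j))"
    (is "?L = ?R")
  proof
    assume ?L then show ?R by fastforce
  next
    assume R: ?R
    show ?L
    proof (intro ballI impI)
      fix i j assume "i \<in> N" "j \<in> N" "i < j" "j < length (x # w)"
      then show "R ((x # w) ! i) ((x # w) ! j)"
        using R by (cases i; cases j) auto
    qed
  qed
  show ?case
    unfolding split
    by (auto simp: nths_Cons IH set_nths)
qed

lemma has_decreasing_subseq_iff:
  "has_decreasing_subseq m w \<longleftrightarrow> (\<exists>D. decreasing_at w D \<and> card D = m)"
proof
  assume "has_decreasing_subseq m w"
  then obtain N where N: "length (nths w N) = m" "sorted_wrt (>) (nths w N)"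
    by (auto simp: has_decreasing_subseq_def subseq_conv_nths)
  have "decreasing_at w {i. i < length w \<and> i \<in> N}"
    using N(2) by (auto simp: decreasing_at_def sorted_wrt_nths_iff)
  then show "\<exists>D. decreasing_at w D \<and> card D = m"
    using N(1) by (auto simp: length_nths)
next
  assume "\<exists>D. decreasing_at w D \<and> card D = m"
  then obtain D where D: "decreasing_at w D" "card D = m"
    by blast
  have "{i. i < length w \<and> i \<in> D} = D"
    using D(1) by (auto simp: decreasing_at_def)
  then have "length (nths w D) = m"
    using D(2) by (simp add: length_nths)
  moreover have "sorted_wrt (>) (nths w D)"
    using D(1) by (auto simp: decreasing_at_def sorted_wrt_nths_iff)
  ultimately show "has_decreasing_subseq m w"
    by (auto simp: has_decreasing_subseq_def subseq_conv_nths)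
qed

text \<open>
  The colour of a position is one less than the largest size of a decreasing set of positions
  starting there. A decreasing set starting at \<open>j\<close> is extended by an earlier position with a
  larger letter, so equal colours exclude descents; and nothing decreases from \<open>0\<close>.
\<close>
lemma greedy_colouring:
  assumes "\<not> has_decreasing_subseq (k + 2) w"
  obtains c :: "nat \<Rightarrow> nat" where
    "\<And>i. i < length w \<Longrightarrow> c i < Suc k"
    "\<And>i. i < length w \<Longrightarrow> w ! i = 0 \<Longrightarrow> c i = 0"
    "\<And>i j. i < j \<Longrightarrow> j < length w \<Longrightarrow> c i = c j \<Longrightarrow> w ! i \<le> w ! j"
proof -
  define C where "C i = {D. decreasing_at w D \<and> i \<in> D \<and> D \<subseteq> {i..}}" for i
  have C_sub: "C i \<subseteq> Pow {..<length w}" for i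
    by (auto simp: C_def decreasing_at_def)
  have fin: "finite (card ` C i)" for i
    by (rule finite_imageI, rule finite_subset[OF C_sub]) simp
  have single: "{i} \<in> C i" if "i < length w" for i
    using that by (auto simp: C_def decreasing_at_def)
  have fin_D: "finite D" if "decreasing_at w D" for D
    using that by (auto simp: decreasing_at_def intro: finite_subset)
  define b where "b i = Max (card ` C i)" for i
  have b_ge: "card D \<le> b i" if "D \<in> C i" for i D
    unfolding b_def by (rule Max_ge[OF fin]) (use that in auto)
  have b_in: "\<exists>D\<in>C i. card D = b i" if "i < length w" for i
    using Max_in[OF fin, of i] single[OF that] unfolding b_def by (metis empty_iff image_iff image_is_empty)
  have b_pos: "1 \<le> b i" if "i < length w" for i
    using b_ge[OF single[OF that]] by simp
  \<comment> \<open>A decreasing set that is too large would contain one of size exactly \<open>k + 2\<close>.\<close>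
  have b_le: "b i \<le> Suc k" if i: "i < length w" for i
  proof (rule ccontr)
    assume "\<not> b i \<le> Suc k"
    obtain D where D: "decreasing_at w D" "card D = b i"
      using b_in[OF i] by (auto simp: C_def)
    obtain E where E: "E \<subseteq> D" "card E = k + 2"
      using obtain_subset_with_card_n[of "k + 2" D] D(2) \<open>\<not> b i \<le> Suc k\<close> by auto
    have "decreasing_at w E"
      using D(1) E(1) by (auto simp: decreasing_at_def)
    then show False
      using assms E(2) by (auto simp: has_decreasing_subseq_iff)
  qed
  show ?thesis
  proof
    show "b i - 1 < Suc k" if "i < length w" for i
      using b_le[OF that] by simp
    show "b i - 1 = 0" if i: "i < length w" and z: "w ! i = 0" for i
    proof -
      obtain D where D: "D \<in> C i" "card D = b i"
        using b_in[OF i] by blast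
      have "D \<subseteq> {i}"
      proof
        fix j assume "j \<in> D"
        then have "\<not> i < j" "i \<le> j"
          using D(1) z by (auto simp: C_def decreasing_at_def)
        then show "j \<in> {i}" by simp
      qed
      then have "card D \<le> 1"
        using card_mono[of "{i}" D] by simp
      then show ?thesis
        using D(2) by simp
    qed
    show "w ! i \<le> w ! j" if ij: "i < j" "j < length w" and eq: "b i - 1 = b j - 1" for i j
    proof (rule ccontr)
      assume "\<not> w ! i \<le> w ! j"
      obtain D where D: "D \<in> C j" "card D = b j"
        using b_in[OF ij(2)] by blast
      have iD: "i \<notin> D"
        using D(1) ij by (auto simp: C_def)
      have below: "w ! x \<le> w ! j" if "x \<in> D" for x
        using D(1) that by (cases "x = j") (auto simp: C_def decreasing_at_def less_imp_le)
      have "insert i D \<in> C i"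
        using D(1) ij below \<open>\<not> w ! i \<le> w ! j\<close>
        by (fastforce simp: C_def decreasing_at_def)
      then have "Suc (card D) \<le> b i"
        using b_ge[of "insert i D" i] iD fin_D D(1) by (simp add: C_def)
      then show False
        using D(2) eq b_pos[OF ij(2)] by simp
    qed
  qed
qed

text \<open>
  The letter \<open>w' ! i\<close> would occur once more in \<open>w'\<close> than in \<open>w\<close>: the prefixes of length \<open>i\<close>
  contain all of its occurrences in \<open>w\<close>.
\<close>
lemma no_extra_occurrence_after_equal_prefix:
  assumes "mset w = mset w'" and "i < length w'" and "take i w = take i w'"
    and "\<And>j. j < length w \<Longrightarrow> w ! j = w' ! i \<Longrightarrow> j < i"
  shows False
proof -
  have len: "length w = length w'"
    using assms(1) by (metis size_mset)
  have "count (mset w') (w' ! i) \<ge> count (mset (take (Suc i) w')) (w' ! i)"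
    by (metis append_take_drop_id count_union le_add1 mset_append)
  moreover have "count (mset (take (Suc i) w')) (w' ! i) = Suc (count (mset (take i w)) (w' ! i))"
    using assms(2,3) by (simp add: take_Suc_conv_app_nth)
  moreover have "w' ! i \<notin> set (drop i w)"
  proof
    assume "w' ! i \<in> set (drop i w)"
    then obtain r where r: "r < length (drop i w)" "drop i w ! r = w' ! i"
      by (metis in_set_conv_nth)
    then have "w ! (i + r) = w' ! i" "i + r < length w"
      by (auto simp: len assms(2))
    then show False
      using assms(4) by fastforce
  qed
  then have "count (mset w) (w' ! i) = count (mset (take i w)) (w' ! i)"
    by (metis add.right_neutral append_take_drop_id count_eq_zero_iff count_union mset_append
        set_mset_mset)
  ultimately show False
    using assms(1) by simp
qed

text \<open>
  At the first difference a smaller \<open>w'\<close> has a letter that is smaller than the letter of \<open>w\<close> and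
  of the same colour. By monotonicity \<open>w\<close> has used up all copies of that letter before.
\<close>
lemma monotone_colouring_lex_min:
  fixes w w' :: "nat list" and a :: "nat \<Rightarrow> nat"
  assumes mset: "mset w = mset w'" and same: "map a w' = map a w"
    and mono: "\<And>i j. i < j \<Longrightarrow> j < length w \<Longrightarrow> a (w ! i) = a (w ! j) \<Longrightarrow> w ! i \<le> w ! j"
  shows "w \<le> w'"
proof (rule ccontr)
  assume "\<not> w \<le> w'"
  then have "w' < w" by simp
  have len: "length w = length w'"
    using mset by (metis size_mset)
  obtain i where i: "i < length w'" "take i w' = take i w" "w' ! i < w ! i"
    using \<open>w' < w\<close> len by (auto simp: list_less_def lexord_take_index_conv)
  have "j < i" if j: "j < length w" "w ! j = w' ! i" for j
  proof (rule ccontr)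
    assume "\<not> j < i"
    moreover have "j \<noteq> i" using i(3) j(2) by auto
    ultimately have "i < j" by simp
    moreover have "a (w ! i) = a (w ! j)"
      using arg_cong[OF same, of "\<lambda>xs. xs ! i"] i(1) j(2) len by simp
    ultimately have "w ! i \<le> w ! j"
      using mono j(1) by blast
    then show False using i(3) j(2) by simp
  qed
  then show False
    using no_extra_occurrence_after_equal_prefix[OF mset i(1) i(2)[symmetric]] by blast
qed

text \<open>
  The first moved position receives the letter of a later position, which is smaller.
\<close>
lemma permute_list_decreasing_less:
  assumes D: "decreasing_at w D" and \<pi>: "\<pi> permutes D" "\<pi> \<noteq> id"
  shows "permute_list \<pi> w < w"
proof -
  have Dw: "D \<subseteq> {..<length w}"
    using D by (simp add: decreasing_at_def)
  have perm: "\<pi> permutes {..<length w}"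
    using \<pi>(1) Dw by (rule permutes_subset)
  define i where "i = (LEAST i. \<pi> i \<noteq> i)"
  have ex: "\<exists>i. \<pi> i \<noteq> i" using \<pi>(2) by auto
  have i: "\<pi> i \<noteq> i"
    unfolding i_def using ex by (rule LeastI_ex)
  have fixed: "\<pi> j = j" if "j < i" for j
    using not_less_Least[of j "\<lambda>i. \<pi> i \<noteq> i"] that unfolding i_def by blast
  have iD: "i \<in> D" "\<pi> i \<in> D"
    using i \<pi>(1) permutes_not_in[OF \<pi>(1)] permutes_in_image[OF \<pi>(1)] by auto
  have "\<not> \<pi> i < i"
    using fixed[of "\<pi> i"] i permutes_inj[OF \<pi>(1)] by (auto dest: injD)
  then have "i < \<pi> i" using i by simp
  then have less: "w ! \<pi> i < w ! i"
    using D iD by (auto simp: decreasing_at_def)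
  have il: "i < length w" using iD Dw by auto
  have "take i (permute_list \<pi> w) = take i w"
    using il by (intro nth_equalityI) (auto simp: permute_list_nth[OF perm] fixed)
  then show ?thesis
    using less il
    by (auto simp: list_less_def lexord_take_index_conv permute_list_nth[OF perm] intro!: exI[of _ i])
qed

lemma permute_list_transpose_equal:
  assumes "xs ! i = xs ! j" "i < length xs" "j < length xs"
  shows "permute_list (transpose i j) xs = xs"
proof (rule nth_equalityI)
  have "transpose i j permutes {..<length xs}"
    using assms by (intro permutes_swap_id) auto
  then show "permute_list (transpose i j) xs ! q = xs ! q"
    if "q < length (permute_list (transpose i j) xs)" for q
    using that assms by (auto simp: permute_list_nth transpose_def)
qed simp

section \<open>Straightening and linear independence\<close>

context vector_space
begin

text \<open>
  Two of the positions in \<open>D\<close> carry equal entries of \<open>xs\<close>, and exchanging them first pairs the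
  terms of the alternating sum off with opposite signs.
\<close>
lemma alternating_sum_permute_list:
  fixes G :: "'c list \<Rightarrow> 'b"
  assumes char: "(2::'a) \<noteq> 0"
    and D: "D \<subseteq> {..<length xs}" "\<not> inj_on (\<lambda>i. xs ! i) D"
  shows "(\<Sum>\<pi> | \<pi> permutes D. of_int (sign \<pi>) *s G (permute_list \<pi> xs)) = 0"
proof -
  obtain i j where ij: "i \<in> D" "j \<in> D" "i \<noteq> j" "xs ! i = xs ! j"
    using D(2) by (auto simp: inj_on_def)
  let ?t = "transpose i j"
  let ?h = "\<lambda>\<pi>. of_int (sign \<pi>) *s G (permute_list \<pi> xs)"
  have fin: "finite D" using D(1) finite_subset by blast
  have t: "?t permutes D" using ij by (intro permutes_swap_id) auto
  have "?h (?t \<circ> \<pi>) = - ?h \<pi>" if "\<pi> permutes D" for \<pi>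
  proof -
    have "permutation \<pi>"
      using that fin permutation_permutes by blast
    then have "sign (?t \<circ> \<pi>) = - sign \<pi>"
      using ij(3) by (simp add: sign_compose permutation_swap_id sign_swap_id)
    moreover have "permute_list ?t xs = xs"
      using ij D(1) by (intro permute_list_transpose_equal) auto
    then have "permute_list (?t \<circ> \<pi>) xs = permute_list \<pi> xs"
      using permutes_subset[OF that D(1)] by (simp add: permute_list_compose)
    ultimately show ?thesis by simp
  qed
  then have neg: "(\<Sum>\<pi> | \<pi> permutes D. ?h (?t \<circ> \<pi>)) = - (\<Sum>\<pi> | \<pi> permutes D. ?h \<pi>)"
    by (simp add: sum_negf)
  have "(\<Sum>\<pi> | \<pi> permutes D. ?h \<pi>) = (\<Sum>\<pi> | \<pi> permutes D. ?h (?t \<circ> \<pi>))"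
  proof -
    have invol: "?t \<circ> (?t \<circ> \<pi>) = \<pi>" for \<pi> :: "nat \<Rightarrow> nat"
      by (simp add: fun_eq_iff)
    have comp: "?t \<circ> \<pi> \<in> {\<pi>. \<pi> permutes D}" if "\<pi> \<in> {\<pi>. \<pi> permutes D}" for \<pi>
      using permutes_compose[OF _ t] that by blast
    show ?thesis
      by (rule sum.reindex_bij_witness[of _ "\<lambda>\<pi>. ?t \<circ> \<pi>" "\<lambda>\<pi>. ?t \<circ> \<pi>"])
        (simp_all only: invol comp)
  qed
  then have "(\<Sum>\<pi> | \<pi> permutes D. ?h \<pi>) = - (\<Sum>\<pi> | \<pi> permutes D. ?h \<pi>)"
    unfolding neg .
  then have "(\<Sum>\<pi> | \<pi> permutes D. ?h \<pi>) + (\<Sum>\<pi> | \<pi> permutes D. ?h \<pi>) = 0"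
    by (rule eq_neg_iff_add_eq_0[THEN iffD1])
  moreover have "2 *s X = X + X" for X
    using scale_left_distrib[of 1 1 X] by simp
  ultimately have "2 *s (\<Sum>\<pi> | \<pi> permutes D. ?h \<pi>) = 0"
    by metis
  then show ?thesis
    using char by (simp only: scale_eq_0_iff simp_thms)
qed

text \<open>
  For a fixed colouring the coloured letters at the \<open>k + 2\<close> decreasing positions take at most
  \<open>k + 1\<close> values, so the alternating sum over the permutations of these positions vanishes. It
  expresses the term of the identity by terms of smaller words.
\<close>
lemma colour_sum_straightening:
  fixes K :: "(nat \<Rightarrow> nat) \<Rightarrow> nat list \<Rightarrow> 'b"
  assumes char: "(2::'a) \<noteq> 0"
    and col: "\<And>a x. a \<in> A \<Longrightarrow> a x < Suc k"
    and dec: "has_decreasing_subseq (k + 2) w"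
  shows "(\<Sum>a\<in>A. K a (map a w)) \<in>
    span {(\<Sum>a\<in>A. K a (map a w')) |w'. mset w' = mset w \<and> w' < w}" (is "?G w \<in> span ?S")
proof -
  obtain D where D: "decreasing_at w D" "card D = k + 2"
    using dec by (auto simp: has_decreasing_subseq_iff)
  have Dw: "D \<subseteq> {..<length w}"
    using D(1) by (simp add: decreasing_at_def)
  have fin: "finite D" using Dw finite_subset by blast
  have perm: "\<pi> permutes {..<length w}" if "\<pi> permutes D" for \<pi>
    using that Dw by (rule permutes_subset)
  have zero: "(\<Sum>\<pi> | \<pi> permutes D. of_int (sign \<pi>) *s K a (permute_list \<pi> (map a w))) = 0"
    if a: "a \<in> A" for a
  proof (rule alternating_sum_permute_list[OF char])
    show "\<not> inj_on ((!) (map a w)) D"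
    proof
      assume inj: "inj_on ((!) (map a w)) D"
      have "(!) (map a w) ` D \<subseteq> {..<Suc k}"
        using Dw col[OF a] by auto
      then have "card D \<le> Suc k"
        using card_inj_on_le[OF inj, of "{..<Suc k}"] by simp
      then show False using D(2) by simp
    qed
  qed (use Dw in auto)
  have "(\<Sum>\<pi> | \<pi> permutes D. of_int (sign \<pi>) *s ?G (permute_list \<pi> w)) =
      (\<Sum>a\<in>A. \<Sum>\<pi> | \<pi> permutes D. of_int (sign \<pi>) *s K a (permute_list \<pi> (map a w)))"
    by (subst sum.swap) (simp add: scale_sum_right permute_list_map[OF perm])
  also have "\<dots> = 0"
    using zero by simp
  finally have "0 = (\<Sum>\<pi> | \<pi> permutes D. of_int (sign \<pi>) *s ?G (permute_list \<pi> w))"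
    by simp
  also have "\<dots> = ?G w +
      (\<Sum>\<pi> \<in> {\<pi>. \<pi> permutes D} - {id}. of_int (sign \<pi>) *s ?G (permute_list \<pi> w))"
    by (subst sum.remove[of _ id])
      (auto simp: finite_permutations[OF fin] permutes_id sign_id)
  finally have "?G w =
      - (\<Sum>\<pi> \<in> {\<pi>. \<pi> permutes D} - {id}. of_int (sign \<pi>) *s ?G (permute_list \<pi> w))"
    by (simp add: eq_neg_iff_add_eq_0)
  also have "\<dots> \<in> span ?S"
  proof (rule span_neg, rule span_sum, rule span_scale)
    fix \<pi> assume "\<pi> \<in> {\<pi>. \<pi> permutes D} - {id}"
    then have "\<pi> permutes D" "\<pi> \<noteq> id" by auto
    then have "mset (permute_list \<pi> w) = mset w" "permute_list \<pi> w < w"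
      using permute_list_decreasing_less[OF D(1)] perm by auto
    then show "?G (permute_list \<pi> w) \<in> span ?S"
      by (intro span_base CollectI exI[of _ "permute_list \<pi> w"]) simp
  qed
  finally show ?thesis .
qed

lemma colour_sum_in_span_avoiders:
  fixes K :: "(nat \<Rightarrow> nat) \<Rightarrow> nat list \<Rightarrow> 'b"
  assumes char: "(2::'a) \<noteq> 0"
    and col: "\<And>a x. a \<in> A \<Longrightarrow> a x < Suc k"
    and fin: "finite {w. mset w = M}" and w: "mset w = M"
  shows "(\<Sum>a\<in>A. K a (map a w)) \<in>
    span ((\<lambda>w. \<Sum>a\<in>A. K a (map a w)) ` {w. mset w = M \<and> \<not> has_decreasing_subseq (k + 2) w})"
    (is "?G w \<in> span ?S")
  using w
proof (induction "card {w'. mset w' = M \<and> w' < w}" arbitrary: w rule: less_induct)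
  case less
  show ?case
  proof (cases "has_decreasing_subseq (k + 2) w")
    case True
    have "?G w' \<in> span ?S" if "mset w' = M" "w' < w" for w'
    proof (rule less.hyps[OF psubset_card_mono])
      show "finite {w'. mset w' = M \<and> w' < w}"
        by (rule finite_subset[OF _ fin]) auto
      show "{v. mset v = M \<and> v < w'} \<subset> {v. mset v = M \<and> v < w}"
        using that less_trans[of _ w' w] by blast
    qed (use that in auto)
    then have "{?G w' |w'. mset w' = mset w \<and> w' < w} \<subseteq> span ?S"
      using less.prems by auto
    then have "span {?G w' |w'. mset w' = mset w \<and> w' < w} \<subseteq> span ?S"
      by (rule span_minimal) simp
    moreover have "?G w \<in> span {?G w' |w'. mset w' = mset w \<and> w' < w}"
      by (rule colour_sum_straightening[OF char _ True]) (rule col)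
    ultimately show ?thesis by blast
  next
    case False
    then show ?thesis
      using less.prems by (intro span_base) auto
  qed
qed

lemma in_span_image_finite:
  assumes "finite F" "y \<in> span (g ` F)"
  shows "\<exists>c. y = (\<Sum>w\<in>F. c w *s g w)"
proof -
  let ?S = "{y. \<exists>c. y = (\<Sum>w\<in>F. c w *s g w)}"
  have "subspace ?S"
  proof (rule subspaceI)
    show "0 \<in> ?S" by (auto intro!: exI[of _ "\<lambda>_. 0"])
    show "x + y \<in> ?S" if "x \<in> ?S" "y \<in> ?S" for x y
    proof -
      obtain a b where "x = (\<Sum>w\<in>F. a w *s g w)" "y = (\<Sum>w\<in>F. b w *s g w)"
        using \<open>x \<in> ?S\<close> \<open>y \<in> ?S\<close> by blast
      then have "x + y = (\<Sum>w\<in>F. (a w + b w) *s g w)"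
        by (simp add: scale_left_distrib sum.distrib)
      then show ?thesis by (intro CollectI exI[of _ "\<lambda>w. a w + b w"])
    qed
    show "c *s x \<in> ?S" if "x \<in> ?S" for c x
    proof -
      obtain a where "x = (\<Sum>w\<in>F. a w *s g w)"
        using \<open>x \<in> ?S\<close> by blast
      then have "c *s x = (\<Sum>w\<in>F. (c * a w) *s g w)"
        by (simp add: scale_sum_right)
      then show ?thesis by (intro CollectI exI[of _ "\<lambda>w. c * a w"])
    qed
  qed
  moreover have "g w \<in> ?S" if "w \<in> F" for w
  proof -
    have "g w = (\<Sum>w'\<in>F. (if w' = w then 1 else 0) *s g w')"
      using assms(1) that by (subst sum.remove[of _ w]) (auto intro!: sum.neutral)
    then show ?thesis
      by (intro CollectI exI[of _ "\<lambda>w'. if w' = w then 1 else 0"])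
  qed
  ultimately show ?thesis
    using span_minimal[of "g ` F" ?S] assms(2) by blast
qed

lemma independent_image:
  assumes "finite F"
    and indep: "\<And>c w. (\<Sum>w\<in>F. c w *s g w) = 0 \<Longrightarrow> w \<in> F \<Longrightarrow> c w = 0"
  shows "inj_on g F" "independent (g ` F)"
proof -
  show inj: "inj_on g F"
  proof (rule inj_onI, rule ccontr)
    fix u w assume uw: "u \<in> F" "w \<in> F" "g u = g w" "u \<noteq> w"
    let ?c = "\<lambda>x. if x = u then 1 :: 'a else if x = w then - 1 else 0"
    have "(\<Sum>x\<in>F. ?c x *s g x) = (\<Sum>x\<in>{u, w}. ?c x *s g x)"
      using assms(1) uw by (intro sum.mono_neutral_right) auto
    also have "\<dots> = g u - g w" using uw(4) by simp
    also have "\<dots> = 0" using uw(3) by simp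
    finally have "?c u = 0" by (rule indep[of ?c u, OF _ uw(1)])
    then show False by simp
  qed
  show "independent (g ` F)"
  proof (rule ccontr)
    assume "\<not> independent (g ` F)"
    then obtain c w where c: "(\<Sum>v\<in>g ` F. c v *s v) = 0" "w \<in> F" "c (g w) \<noteq> 0"
      using dependent_finite[of "g ` F"] assms(1) by auto
    have "(\<Sum>w\<in>F. c (g w) *s g w) = 0"
      using c(1) by (simp add: sum.reindex[OF inj])
    then show False using indep[of "\<lambda>w. c (g w)"] c(2,3) by blast
  qed
qed

end

section \<open>Fermionic Fock space\<close>

text \<open>
  A vector assigns an amplitude to every set of occupied modes. Arbitrary functions are allowed;
  the vectors that matter are supported on the subsets of a fixed finite set of modes.
\<close>
type_synonym fock = "nat set \<Rightarrow> complex"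

definition fscale :: "complex \<Rightarrow> fock \<Rightarrow> fock" where
  "fscale c y = (\<lambda>S. c * y S)"

interpretation fock: vector_space fscale
  by unfold_locales (auto simp: fscale_def fun_eq_iff algebra_simps)

text \<open>
  The Jordan-Wigner sign, which makes the operators of different modes anticommute.
\<close>
definition jw_sign :: "nat \<Rightarrow> nat set \<Rightarrow> complex" where
  "jw_sign x S = (- 1) ^ card (S \<inter> {..<x})"

definition create :: "nat \<Rightarrow> fock \<Rightarrow> fock" where
  "create x y = (\<lambda>S. if x \<in> S then jw_sign x S * y (S - {x}) else 0)"

definition annih :: "nat \<Rightarrow> fock \<Rightarrow> fock" where
  "annih x y = (\<lambda>S. if x \<in> S then 0 else jw_sign x S * y (insert x S))"

definition ket :: "nat set \<Rightarrow> fock" where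
  "ket S = (\<lambda>T. if T = S then 1 else 0)"

lemma jw_sign_insert:
  "z \<notin> S \<Longrightarrow> jw_sign x (insert z S) = (if z < x then - jw_sign x S else jw_sign x S)"
  by (auto simp: jw_sign_def Int_insert_left)

lemma jw_sign_remove:
  assumes "z \<in> S"
  shows "jw_sign x (S - {z}) = (if z < x then - jw_sign x S else jw_sign x S)"
  using jw_sign_insert[of z "S - {z}" x] assms by (auto simp: insert_absorb split: if_splits)

lemma jw_sign_square: "jw_sign x S * jw_sign x S = 1"
  by (simp add: jw_sign_def flip: power_mult_distrib)

lemma jw_sign_nonzero: "jw_sign x S \<noteq> 0"
  by (simp add: jw_sign_def)

lemma cnj_jw_sign: "cnj (jw_sign x S) = jw_sign x S"
  by (simp add: jw_sign_def)

lemma create_linear: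
  "create x (y + z) = create x y + create x z" "create x (y - z) = create x y - create x z"
  "create x (- y) = - create x y" "create x 0 = 0" "create x (fscale c y) = fscale c (create x y)"
  by (auto simp: create_def fscale_def fun_eq_iff algebra_simps)

lemma annih_linear:
  "annih x (y + z) = annih x y + annih x z" "annih x (y - z) = annih x y - annih x z"
  "annih x (- y) = - annih x y" "annih x 0 = 0" "annih x (fscale c y) = fscale c (annih x y)"
  by (auto simp: annih_def fscale_def fun_eq_iff algebra_simps)

lemma create_sum: "create x (\<Sum>i\<in>I. g i) = (\<Sum>i\<in>I. create x (g i))"
  by (rule additive.sum[of "create x"]) (rule additive.intro, rule create_linear)

lemma annih_sum: "annih x (\<Sum>i\<in>I. g i) = (\<Sum>i\<in>I. annih x (g i))"
  by (rule additive.sum[of "annih x"]) (rule additive.intro, rule annih_linear)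

lemma create_create: "create x (create z y) = - create z (create x y)"
proof
  fix S
  have "S - {x} - {z} = S - {z} - {x}" by auto
  then show "create x (create z y) S = (- create z (create x y)) S"
    by (cases x z rule: linorder_cases) (auto simp: create_def jw_sign_remove)
qed

lemma annih_annih: "annih x (annih z y) = - annih z (annih x y)"
proof
  fix S
  have "insert x (insert z S) = insert z (insert x S)" by auto
  then show "annih x (annih z y) S = (- annih z (annih x y)) S"
    by (cases x z rule: linorder_cases) (auto simp: annih_def jw_sign_insert)
qed

lemma annih_create: "annih x (create z y) = (if x = z then y else 0) - create z (annih x y)"
proof (cases "x = z")
  case True
  have "jw_sign x S * (jw_sign x S * t) = t" for S t
    by (simp add: jw_sign_square flip: mult.assoc)
  then show ?thesis
    using True
    by (auto simp: fun_eq_iff annih_def create_def jw_sign_insert jw_sign_remove insert_absorb)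
next
  case False
  have "insert x S - {z} = insert x (S - {z})" for S
    using False by auto
  then show ?thesis
    using False
    by (cases x z rule: linorder_cases)
      (auto simp: fun_eq_iff annih_def create_def jw_sign_insert jw_sign_remove)
qed

lemma create_ket: "create x (ket S) = (if x \<in> S then 0 else fscale (jw_sign x S) (ket (insert x S)))"
proof (intro ext)
  fix T
  have "x \<in> T \<Longrightarrow> T - {x} = S \<longleftrightarrow> x \<notin> S \<and> T = insert x S" by auto
  then show "create x (ket S) T =
      (if x \<in> S then 0 else fscale (jw_sign x S) (ket (insert x S))) T"
    by (auto simp: create_def ket_def fscale_def jw_sign_insert)
qed

lemma annih_ket: "annih x (ket S) = (if x \<in> S then fscale (jw_sign x S) (ket (S - {x})) else 0)"
proof (intro ext)
  fix T
  have "x \<notin> T \<Longrightarrow> insert x T = S \<longleftrightarrow> x \<in> S \<and> T = S - {x}" by auto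
  then show "annih x (ket S) T =
      (if x \<in> S then fscale (jw_sign x S) (ket (S - {x})) else 0) T"
    by (auto simp: annih_def ket_def fscale_def jw_sign_remove)
qed

text \<open>
  The standard hermitian form on the span of the subsets of the first \<open>N\<close> modes.
\<close>
definition finner :: "nat \<Rightarrow> fock \<Rightarrow> fock \<Rightarrow> complex" where
  "finner N y z = (\<Sum>S\<in>Pow {..<N}. cnj (y S) * z S)"

lemma finner_linear:
  "finner N (y + y') z = finner N y z + finner N y' z"
  "finner N y (z + z') = finner N y z + finner N y z'"
  "finner N (fscale c y) z = cnj c * finner N y z"
  "finner N y 0 = 0" "finner N 0 y = 0"
  by (simp_all add: finner_def fscale_def algebra_simps sum.distrib sum_distrib_left)

lemma finner_sum:
  "finner N (\<Sum>i\<in>I. g i) z = (\<Sum>i\<in>I. finner N (g i) z)"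
  "finner N y (\<Sum>i\<in>I. g i) = (\<Sum>i\<in>I. finner N y (g i))"
  using additive.sum[of "\<lambda>y. finner N y z" g I] additive.sum[of "finner N y" g I]
  by (simp_all add: additive_def finner_linear)

lemma finner_create:
  assumes "x < N"
  shows "finner N (create x y) z = finner N y (annih x z)"
proof -
  have "finner N (create x y) z =
      (\<Sum>S | S \<in> Pow {..<N} \<and> x \<in> S. jw_sign x S * cnj (y (S - {x})) * z S)"
    unfolding finner_def by (rule sum.mono_neutral_cong_right) (auto simp: create_def cnj_jw_sign)
  also have "\<dots> = (\<Sum>S | S \<in> Pow {..<N} \<and> x \<notin> S. jw_sign x S * cnj (y S) * z (insert x S))"
    by (rule sum.reindex_bij_witness[of _ "insert x" "\<lambda>S. S - {x}"])
      (use assms in \<open>auto simp: jw_sign_insert jw_sign_remove insert_absorb\<close>)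
  also have "\<dots> = finner N y (annih x z)"
    unfolding finner_def by (rule sum.mono_neutral_cong_left) (auto simp: annih_def)
  finally show ?thesis .
qed

lemma finner_commute: "finner N y z = cnj (finner N z y)"
  by (simp add: finner_def cnj_sum mult.commute)

lemma finner_annih: "x < N \<Longrightarrow> finner N (annih x y) z = finner N y (create x z)"
  using finner_create[of x N z y] finner_commute by metis

definition supported :: "nat \<Rightarrow> fock \<Rightarrow> bool" where
  "supported N y \<longleftrightarrow> (\<forall>S. \<not> S \<subseteq> {..<N} \<longrightarrow> y S = 0)"

lemma finner_definite:
  assumes "supported N y" "finner N y y = 0"
  shows "y = 0"
proof
  fix S
  have "finner N y y = complex_of_real (\<Sum>S\<in>Pow {..<N}. (cmod (y S))\<^sup>2)"
    by (simp add: finner_def complex_norm_square mult.commute del: of_real_power)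
  then have "(\<Sum>S\<in>Pow {..<N}. (cmod (y S))\<^sup>2) = 0"
    using assms(2) by (metis of_real_eq_0_iff)
  then have "\<forall>S\<in>Pow {..<N}. (cmod (y S))\<^sup>2 = 0"
    by (subst (asm) sum_nonneg_eq_0_iff) auto
  then show "y S = 0 S"
    using assms(1) by (cases "S \<subseteq> {..<N}") (auto simp: supported_def)
qed

section \<open>Matrix units on a grid of modes\<close>

text \<open>
  The modes form a grid of rows and \<open>k + 1\<close> columns; \<open>l\<close> is the number of rows that are full in
  the highest weight vector, and \<open>s\<close> the number of rows below them with a single particle.
\<close>
locale fock_grid =
  fixes k l s :: nat
begin

text \<open>
  The number of columns, kept as a constant so that sums over the columns are not split at
  \<open>Suc k\<close>.
\<close>
definition d :: nat where "d = Suc k"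

lemma d_pos: "0 < d"
  by (simp add: d_def)

text \<open>
  Numbering the modes row by row is what makes the Jordan-Wigner signs independent of the columns
  of the particles in the rows above.
\<close>
definition mode :: "nat \<Rightarrow> nat \<Rightarrow> nat" where
  "mode r c = r * d + c"

text \<open>
  The matrix unit \<open>E b a\<close> of \<open>gl n\<close>, acting by derivations on the exterior algebra of the grid.
\<close>
definition E :: "nat \<Rightarrow> nat \<Rightarrow> fock \<Rightarrow> fock" where
  "E b a y = (\<Sum>c<d. create (mode b c) (annih (mode a c) y))"

lemma mode_div_mod: "c < d \<Longrightarrow> mode r c div d = r" "c < d \<Longrightarrow> mode r c mod d = c"
  by (auto simp: mode_def)

lemma mode_eq_iff: "c < d \<Longrightarrow> c' < d \<Longrightarrow> mode r c = mode r' c' \<longleftrightarrow> r = r' \<and> c = c'"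
  using mode_div_mod by metis

lemma mode_less: "r < n \<Longrightarrow> c < d \<Longrightarrow> mode r c < n * d"
  by (metis mode_div_mod(1) div_less_iff_less_mult d_pos)

lemma E_linear:
  "E b a (y + z) = E b a y + E b a z" "E b a (y - z) = E b a y - E b a z"
  "E b a 0 = 0" "E b a (fscale c y) = fscale c (E b a y)"
  by (simp_all add: E_def create_linear annih_linear sum.distrib sum_subtractf fock.scale_sum_right)

lemma E_sum: "E b a (\<Sum>i\<in>I. g i) = (\<Sum>i\<in>I. E b a (g i))"
  by (rule additive.sum[of "E b a"]) (rule additive.intro, rule E_linear)

lemma E_create:
  assumes "c < d"
  shows "E b a (create (mode r c) y) =
    create (mode r c) (E b a y) + (if a = r then create (mode b c) y else 0)"
proof -
  have "create (mode b c') (annih (mode a c') (create (mode r c) y)) =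
      create (mode r c) (create (mode b c') (annih (mode a c') y)) +
      (if c' = c then (if a = r then create (mode b c) y else 0) else 0)" if "c' < d" for c'
    using that assms
    by (auto simp: annih_create create_linear mode_eq_iff create_create[of "mode b c'" "mode r c"])
  then show ?thesis
    using assms by (simp add: E_def create_sum sum.distrib sum.delta)
qed

lemma E_annih:
  assumes "c < d"
  shows "E b a (annih (mode r c) y) =
    annih (mode r c) (E b a y) - (if b = r then annih (mode a c) y else 0)"
proof -
  have "create (mode b c') (annih (mode a c') (annih (mode r c) y)) =
      annih (mode r c) (create (mode b c') (annih (mode a c') y)) -
      (if c' = c then (if b = r then annih (mode a c) y else 0) else 0)" if "c' < d" for c'
    using that assms
    by (auto simp: annih_create create_linear mode_eq_iff annih_annih[of "mode a c'" "mode r c"]) 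
  then show ?thesis
    using assms by (simp add: E_def annih_sum sum_subtractf sum.delta)
qed

lemma E_commute:
  "E b a (E b' a' y) = E b' a' (E b a y) + (if a = b' then E b a' y else 0)
     - (if b = a' then E b' a y else 0)"
proof -
  have "E b a (E b' a' y) = (\<Sum>c<d. create (mode b' c) (annih (mode a' c) (E b a y))
      + (if a = b' then create (mode b c) (annih (mode a' c) y) else 0)
      - (if b = a' then create (mode b' c) (annih (mode a c) y) else 0))"
    unfolding E_def[of b' a' y] E_sum
    by (intro sum.cong refl) (simp add: E_create E_annih create_linear)
  also have "\<dots> = E b' a' (E b a y) + (if a = b' then E b a' y else 0)
     - (if b = a' then E b' a y else 0)"
    by (simp add: sum.distrib sum_subtractf E_def[of b' a'] E_def[of b a' y] E_def[of b' a y])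
  finally show ?thesis .
qed

lemma finner_E: "a < n \<Longrightarrow> b < n \<Longrightarrow> finner (n * d) (E b a y) z = finner (n * d) y (E a b z)"
  by (simp add: E_def finner_sum finner_create finner_annih mode_less)

lemma supported_E:
  assumes "supported (n * d) y" "a < n" "b < n"
  shows "supported (n * d) (E b a y)"
proof -
  have c: "supported N (create x z)" if "supported N z" "x < N" for N x z
    unfolding supported_def create_def
  proof (intro allI impI)
    fix S :: "nat set" assume "\<not> S \<subseteq> {..<N}"
    then have "\<not> S - {x} \<subseteq> {..<N}" using that(2) by auto
    then show "(if x \<in> S then jw_sign x S * z (S - {x}) else 0) = 0"
      using that(1) by (simp add: supported_def)
  qed
  have a: "supported N (annih x z)" if "supported N z" for N x z
    using that by (auto simp: supported_def annih_def)
  have sum: "supported N (\<Sum>i\<in>I. g i)" if "\<And>i. i \<in> I \<Longrightarrow> supported N (g i)"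
    for N and I :: "nat set" and g
    using that
  proof (induction I rule: infinite_finite_induct)
    case (insert i I)
    then have "supported N (g i)" "supported N (\<Sum>i\<in>I. g i)" by auto
    then show ?case
      unfolding sum.insert[OF insert.hyps] by (simp add: supported_def)
  qed (simp_all add: supported_def)
  show ?thesis
    unfolding E_def by (intro sum c a assms(1) mode_less assms(3)) simp
qed

lemma E_ket:
  "E b a (ket S) = (\<Sum>c<d. if mode a c \<in> S \<and> mode b c \<notin> S - {mode a c}
     then fscale (jw_sign (mode a c) S * jw_sign (mode b c) (S - {mode a c}))
            (ket (insert (mode b c) (S - {mode a c})))
     else 0)"
  unfolding E_def by (intro sum.cong refl) (auto simp: annih_ket create_linear create_ket)

section \<open>Words as vectors of the Fock space\<close>

text \<open>
  The pair \<open>(q, x)\<close> stands for the letter \<open>x\<close> at position \<open>q\<close>. Positions correspond to the rows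
  from \<open>l\<close> on, and a nonzero letter \<open>x\<close> to the row \<open>x - 1\<close>.
\<close>
definition letter_op :: "nat \<times> nat \<Rightarrow> fock \<Rightarrow> fock" where
  "letter_op p = (if snd p = 0 then create (mode (l + fst p) 0) else E (l + fst p) (snd p - 1))"

definition word_vec :: "(nat \<times> nat) list \<Rightarrow> fock" where
  "word_vec L = foldr letter_op L (ket {..<l * d})"

text \<open>
  The occupied modes after carrying out the letters of \<open>P\<close>, each in the column given by its colour:
  every nonzero letter of \<open>P\<close> leaves a hole in one of the full rows, and every pair of \<open>P\<close> a
  particle in the row of its position.
\<close>
definition conf :: "(nat \<Rightarrow> nat) \<Rightarrow> (nat \<times> nat) set \<Rightarrow> nat set" where
  "conf a P = {z. if z div d < l
     then \<not> (Suc (z div d) \<in> snd ` P \<and> a (Suc (z div d)) = z mod d)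
     else \<exists>x. (z div d - l, x) \<in> P \<and> a x = z mod d}"

text \<open>
  Colours outside \<open>X\<close> are pinned to \<open>0\<close>: this makes the colour of the letter \<open>0\<close> the column \<open>0\<close>, and
  makes colourings with the same values on \<open>X\<close> equal.
\<close>
definition colourings :: "nat set \<Rightarrow> (nat \<Rightarrow> nat) set" where
  "colourings X = {a. \<forall>x. if x \<in> X then a x < d else a x = 0}"

definition colour_sign :: "(nat \<Rightarrow> nat) \<Rightarrow> complex" where
  "colour_sign a = (- 1) ^ (\<Sum>i\<in>{1..l}. a i)"

definition conf_sum :: "(nat \<times> nat) set \<Rightarrow> fock" where
  "conf_sum P = (\<Sum>a\<in>colourings (snd ` P - {0}). fscale (colour_sign a) (ket (conf a P)))"

lemma letter_op_linear:
  "letter_op p (y + z) = letter_op p y + letter_op p z"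
  "letter_op p 0 = 0" "letter_op p (fscale c y) = fscale c (letter_op p y)"
  by (simp_all add: letter_op_def create_linear E_linear)

lemma letter_op_sum: "letter_op p (\<Sum>i\<in>I. g i) = (\<Sum>i\<in>I. letter_op p (g i))"
  by (rule additive.sum[of "letter_op p"]) (rule additive.intro, rule letter_op_linear)

lemma mode_in_conf:
  "c < d \<Longrightarrow> mode r c \<in> conf a P \<longleftrightarrow>
    (if r < l then \<not> (Suc r \<in> snd ` P \<and> a (Suc r) = c) else \<exists>x. (r - l, x) \<in> P \<and> a x = c)"
  by (simp add: conf_def mode_div_mod)

lemma conf_empty: "conf a {} = {..<l * d}"
  by (auto simp: conf_def div_less_iff_less_mult[OF d_pos])

lemma colourings_less: "a \<in> colourings X \<Longrightarrow> a x < d"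
  using d_pos by (cases "x \<in> X") (auto simp: colourings_def)

lemma colourings_zero: "a \<in> colourings X \<Longrightarrow> x \<notin> X \<Longrightarrow> a x = 0"
  by (auto simp: colourings_def)

lemma sum_colourings_insert:
  assumes "x \<notin> X"
  shows "(\<Sum>a\<in>colourings (insert x X). G a) = (\<Sum>a\<in>colourings X. \<Sum>c<d. G (a(x := c)))"
proof -
  have "(\<Sum>a\<in>colourings (insert x X). G a) = (\<Sum>(a, c)\<in>colourings X \<times> {..<d}. G (a(x := c)))"
    by (rule sum.reindex_bij_witness[of _ "\<lambda>(a, c). a(x := c)" "\<lambda>a. (a(x := 0), a x)"])
      (use assms in \<open>auto simp: colourings_def fun_eq_iff split: if_splits\<close>)
  then show ?thesis
    by (simp add: sum.cartesian_product)
qed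

lemma finite_colourings: "finite X \<Longrightarrow> finite (colourings X)"
proof (induction X rule: finite_induct)
  case empty
  have "colourings {} = {\<lambda>_. 0}" by (auto simp: colourings_def)
  then show ?case by simp
next
  case (insert x X)
  have "colourings (insert x X) \<subseteq> (\<lambda>(a, c). a(x := c)) ` (colourings X \<times> {..<d})"
  proof
    fix a assume "a \<in> colourings (insert x X)"
    then have "a = (\<lambda>(a, c). a(x := c)) (a(x := 0), a x)" "(a(x := 0), a x) \<in> colourings X \<times> {..<d}"
      using insert.hyps(2) by (auto simp: colourings_def split: if_splits)
    then show "a \<in> (\<lambda>(a, c). a(x := c)) ` (colourings X \<times> {..<d})" by blast
  qed
  then show ?case
    using insert.IH finite_subset by blast
qed

lemma mode_add: "mode r c = mode r 0 + c"
  by (simp add: mode_def)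

lemma mode_Suc: "mode (Suc r) 0 = mode r d"
  by (simp add: mode_def)

lemma card_below_mode:
  "card (S \<inter> {..<mode r c}) = card (S \<inter> {..<mode r 0}) + card {c'. c' < c \<and> mode r c' \<in> S}"
proof -
  have "S \<inter> {..<mode r c} = (S \<inter> {..<mode r 0}) \<union> mode r ` {c'. c' < c \<and> mode r c' \<in> S}"
  proof (intro Set.set_eqI iffI)
    fix z assume z: "z \<in> S \<inter> {..<mode r c}"
    show "z \<in> (S \<inter> {..<mode r 0}) \<union> mode r ` {c'. c' < c \<and> mode r c' \<in> S}"
    proof (cases "z < mode r 0")
      case False
      then have "z = mode r (z - mode r 0)" "z - mode r 0 < c"
        using z mode_add[of r c] mode_add[of r "z - mode r 0"] by auto
      then show ?thesis using z by (metis (no_types, lifting) Int_iff UnI2 image_eqI mem_Collect_eq)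
    qed (use z in auto)
  qed (use mode_add in \<open>auto simp: mode_def\<close>)
  moreover have "card (mode r ` T) = card T" for T
    by (intro card_image) (auto simp: inj_on_def mode_def)
  moreover have "(S \<inter> {..<mode r 0}) \<inter> mode r ` {c'. c' < c \<and> mode r c' \<in> S} = {}"
    by (auto simp: mode_def)
  ultimately show ?thesis
    by (simp add: card_Un_disjoint)
qed

lemma jw_sign_mode:
  "jw_sign (mode r c) S = jw_sign (mode r 0) S * (- 1) ^ card {c'. c' < c \<and> mode r c' \<in> S}"
  by (simp add: jw_sign_def card_below_mode[of S r c] power_add)

lemma card_below_row:
  "card (S \<inter> {..<mode r 0}) = (\<Sum>i<r. card {c'. c' < d \<and> mode i c' \<in> S})"
  by (induction r) (simp_all add: mode_Suc card_below_mode[of S _ d], simp add: mode_def)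

text \<open>
  The number of particles in a row does not depend on the colouring: a full row has lost at most one
  particle, and each other row has at most one because positions are not repeated.
\<close>
lemma jw_sign_conf:
  assumes "inj_on fst P" and a: "a \<in> colourings X" "a' \<in> colourings X"
  shows "jw_sign (mode r 0) (conf a P) = jw_sign (mode r 0) (conf a' P)"
proof -
  have row: "card {c'. c' < d \<and> mode i c' \<in> conf b P} =
      (if i < l then if Suc i \<in> snd ` P then d - 1 else d else of_bool (i - l \<in> fst ` P))"
    if b: "b \<in> colourings X" for b i
  proof (cases "i < l")
    case True
    then have "{c'. c' < d \<and> mode i c' \<in> conf b P} =
        (if Suc i \<in> snd ` P then {..<d} - {b (Suc i)} else {..<d})"
      by (cases "Suc i \<in> snd ` P")
        (simp_all add: mode_in_conf Set.set_eq_iff del: image_iff cong: conj_cong, auto)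
    then show ?thesis
      using True colourings_less[OF b] by simp
  next
    case False
    show ?thesis
    proof (cases "i - l \<in> fst ` P")
      case True
      then obtain x where x: "(i - l, x) \<in> P" by auto
      have "x' = x" if "(i - l, x') \<in> P" for x'
        using inj_onD[OF assms(1) _ that x] by simp
      then have "(\<exists>y. (i - l, y) \<in> P \<and> b y = c') \<longleftrightarrow> c' = b x" for c'
        using x by metis
      then have "{c'. c' < d \<and> mode i c' \<in> conf b P} = {b x}"
        using False colourings_less[OF b, of x] by (auto simp: mode_in_conf)
      then show ?thesis using True False by simp
    next
      case out: False
      then have "(i - l, y) \<notin> P" for y
        using image_iff by fastforce
      then have "{c'. c' < d \<and> mode i c' \<in> conf b P} = {}"
        using False by (simp add: mode_in_conf cong: conj_cong)
      then show ?thesis using False out by simp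
    qed
  qed
  show ?thesis
    unfolding jw_sign_def card_below_row row[OF a(1)] row[OF a(2)] ..
qed

lemma conf_insert_zero:
  assumes "a 0 = 0"
  shows "insert (mode (l + q) 0) (conf a P) = conf a (insert (q, 0) P)"
proof (intro Set.set_eqI)
  fix z
  have "z = mode (l + q) 0 \<longleftrightarrow> z div d = l + q \<and> z mod d = 0"
    using d_pos by (metis mode_div_mod div_mult_mod_eq mode_def)
  then show "z \<in> insert (mode (l + q) 0) (conf a P) \<longleftrightarrow> z \<in> conf a (insert (q, 0) P)"
    using assms by (auto simp: conf_def)
qed

lemma conf_insert_pair:
  assumes x: "x \<notin> snd ` P" "x \<noteq> 0" "x \<le> l" and c: "c < d"
  shows "insert (mode (l + q) c) (conf a P - {mode (x - 1) c}) = conf (a(x := c)) (insert (q, x) P)"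
proof (intro Set.set_eqI)
  fix z
  have z: "z = mode r c \<longleftrightarrow> z div d = r \<and> z mod d = c" for r
    using c by (metis mode_div_mod div_mult_mod_eq mode_def)
  have "(i, x) \<notin> P" for i
    using x(1) by force
  then have ex: "(\<exists>y. (t, y) \<in> insert (q, x) P \<and> (a(x := c)) y = u) \<longleftrightarrow>
      (t = q \<and> c = u) \<or> (\<exists>y. (t, y) \<in> P \<and> a y = u)" for t u
    by (auto split: if_splits) metis+
  have other': "(a(x := c)) y = a y" if "y \<in> snd ` P" for y
    using that x(1) by auto
  show "z \<in> insert (mode (l + q) c) (conf a P - {mode (x - 1) c}) \<longleftrightarrow>
      z \<in> conf (a(x := c)) (insert (q, x) P)"
  proof (cases "z div d < l")
    case True
    then show ?thesis
      unfolding insert_iff Diff_iff z conf_def mem_Collect_eq if_P[OF True]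
      using x other' by (cases "x = Suc (z div d)") auto
  next
    case False
    then have "z div d \<noteq> x - 1" using x by simp
    then show ?thesis
      unfolding insert_iff[of z] Diff_iff empty_iff z conf_def mem_Collect_eq if_not_P[OF False] ex
      using False by auto
  qed
qed

text \<open>
  Creating a particle in row \<open>l + q\<close> or a hole in row \<open>x - 1\<close> of column \<open>c\<close> costs a sign; the rows
  above contribute to it only through the number of their particles, which does not depend on the
  colouring, so that the colouring enters the sign through \<open>c\<close> alone.
\<close>
lemma word_vec_eq_conf_sum:
  assumes "distinct (map fst L)" "distinct (filter (\<lambda>x. x \<noteq> 0) (map snd L))" "\<forall>x\<in>snd ` set L. x \<le> l"
  shows "\<exists>g. g \<noteq> 0 \<and> word_vec L = fscale g (conf_sum (set L))"
  using assms
proof (induction L)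
  case Nil
  have "colourings {} = {\<lambda>_. 0}" by (auto simp: colourings_def)
  then have "word_vec [] = fscale 1 (conf_sum (set []))"
    by (simp add: word_vec_def conf_sum_def conf_empty colour_sign_def)
  then show ?case using zero_neq_one by metis
next
  case (Cons p L)
  obtain q x where p: "p = (q, x)" by (cases p)
  let ?X = "snd ` set L - {0}"
  have "distinct (filter (\<lambda>x. x \<noteq> 0) (map snd L))"
    using Cons.prems(2) by (simp split: if_splits)
  then obtain g where g: "g \<noteq> 0" "word_vec L = fscale g (conf_sum (set L))"
    using Cons by auto
  have q: "q \<notin> fst ` set L" and inj: "inj_on fst (set L)"
    using Cons.prems(1) by (auto simp: p distinct_map)
  have vec: "word_vec (p # L) =
      fscale g (\<Sum>a\<in>colourings ?X. fscale (colour_sign a) (letter_op p (ket (conf a (set L)))))"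
    using g(2) by (simp add: word_vec_def conf_sum_def letter_op_linear letter_op_sum)
  have mode_out: "mode (l + q) c \<notin> conf a (set L)" if "c < d" for a c
    using q that by (force simp: mode_in_conf)
  let ?b = "\<lambda>_::nat. 0::nat"
  have b: "?b \<in> colourings ?X" by (auto simp: colourings_def d_pos)
  \<comment> \<open>The signs are evaluated at the constant colouring \<open>?b\<close>, which serves for all colourings.\<close>
  define \<rho> where "\<rho> = jw_sign (mode (l + q) 0) (conf ?b (set L))"
  have \<rho>: "jw_sign (mode (l + q) 0) (conf a (set L)) = \<rho>" if "a \<in> colourings ?X" for a
    unfolding \<rho>_def by (rule jw_sign_conf[OF inj that b])
  show ?case
  proof (cases "x = 0")
    case True
    have "letter_op p (ket (conf a (set L))) = fscale \<rho> (ket (conf a (set (p # L))))"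
      if a: "a \<in> colourings ?X" for a
      using mode_out[OF d_pos] \<rho>[OF a] colourings_zero[OF a, of 0] True
      by (simp add: letter_op_def p create_ket conf_insert_zero)
    then have "word_vec (p # L) = fscale (g * \<rho>) (conf_sum (set (p # L)))"
      unfolding vec using True by (simp add: conf_sum_def p fock.scale_sum_right mult_ac)
    moreover have "g * \<rho> \<noteq> 0"
      using g(1) by (simp add: \<rho>_def jw_sign_nonzero)
    ultimately show ?thesis by blast
  next
    case False
    have x: "x \<notin> snd ` set L" "x \<noteq> 0" "x \<le> l"
      using Cons.prems(2,3) False by (auto simp: p)
    define \<sigma> where "\<sigma> = jw_sign (mode (x - 1) 0) (conf ?b (set L))"
    have "letter_op p (ket (conf a (set L))) =
        (\<Sum>c<d. fscale (- \<sigma> * \<rho> * (- 1) ^ c) (ket (conf (a(x := c)) (set (p # L)))))"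
      if a: "a \<in> colourings ?X" for a
    proof -
      have "(if mode (x - 1) c \<in> conf a (set L) \<and> mode (l + q) c \<notin> conf a (set L) - {mode (x - 1) c}
         then fscale (jw_sign (mode (x - 1) c) (conf a (set L)) *
                jw_sign (mode (l + q) c) (conf a (set L) - {mode (x - 1) c}))
              (ket (insert (mode (l + q) c) (conf a (set L) - {mode (x - 1) c})))
         else 0) = fscale (- \<sigma> * \<rho> * (- 1) ^ c) (ket (conf (a(x := c)) (set (p # L))))"
        if c: "c < d" for c
      proof -
        have full: "mode (x - 1) c' \<in> conf a (set L)" if "c' < d" for c'
        proof -
          have "x - 1 < l" "Suc (x - 1) = x" using x by auto
          then show ?thesis
            using that x(1) unfolding mode_in_conf[OF that] by simp
        qed
        have "{c'. c' < c \<and> mode (x - 1) c' \<in> conf a (set L)} = {..<c}"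
          using full c by auto
        then have 1: "jw_sign (mode (x - 1) c) (conf a (set L)) = \<sigma> * (- 1) ^ c"
          using jw_sign_conf[OF inj a b] by (simp add: jw_sign_mode[of _ c] \<sigma>_def)
        have "{c'. c' < c \<and> mode (l + q) c' \<in> conf a (set L)} = {}"
          using mode_out c by auto
        then have 2: "jw_sign (mode (l + q) c) (conf a (set L)) = \<rho>"
          by (subst jw_sign_mode) (simp only: \<rho>[OF a] card.empty power_0 mult_1_right)
        have "mode (x - 1) c < mode (l + q) c"
          using x d_pos by (simp add: mode_def)
        then show ?thesis
          using c full mode_out conf_insert_pair[OF x c, of q a]
          by (simp add: jw_sign_remove 1[unfolded One_nat_def] 2 p)
      qed
      then have "E (l + q) (x - 1) (ket (conf a (set L))) =
          (\<Sum>c<d. fscale (- \<sigma> * \<rho> * (- 1) ^ c) (ket (conf (a(x := c)) (set (p # L)))))"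
        unfolding E_ket by (intro sum.cong refl) (simp only: lessThan_iff)
      then show ?thesis
        using False by (simp add: letter_op_def p)
    qed
    moreover have "colour_sign (a(x := c)) = colour_sign a * (- 1) ^ c" if a: "a \<in> colourings ?X" for a c
    proof -
      have "a x = 0" using colourings_zero[OF a, of x] x by auto
      have "(\<Sum>i\<in>{1..l}. (a(x := c)) i) = c + (\<Sum>i\<in>{1..l} - {x}. a i)"
        using x by (subst sum.remove[of _ x]) auto
      moreover have "(\<Sum>i\<in>{1..l}. a i) = (\<Sum>i\<in>{1..l} - {x}. a i)"
        using x \<open>a x = 0\<close> by (subst sum.remove[of _ x]) auto
      ultimately show ?thesis
        by (simp add: colour_sign_def power_add)
    qed
    ultimately have "word_vec (p # L) = fscale (- g * \<sigma> * \<rho>)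
        (\<Sum>a\<in>colourings ?X. \<Sum>c<d. fscale (colour_sign (a(x := c))) (ket (conf (a(x := c)) (set (p # L)))))"
      unfolding vec by (simp add: fock.scale_sum_right mult_ac)
    also have "\<dots> = fscale (- g * \<sigma> * \<rho>) (conf_sum (set (p # L)))"
    proof -
      have X: "snd ` set (p # L) - {0} = insert x ?X" "x \<notin> ?X"
        using x by (auto simp: p)
      show ?thesis
        unfolding conf_sum_def X(1) sum_colourings_insert[OF X(2)] ..
    qed
    finally show ?thesis
      using g(1) by (intro exI[of _ "- g * \<sigma> * \<rho>"]) (simp add: \<rho>_def \<sigma>_def jw_sign_nonzero)
  qed
qed

section \<open>Lowering operators on words\<close>

abbreviation num_rows :: nat where "num_rows \<equiv> 2 * l + s"

text \<open>
  The number of particles in each row after carrying out the letters of \<open>L\<close>.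
\<close>
definition occ :: "(nat \<times> nat) list \<Rightarrow> nat \<Rightarrow> int" where
  "occ L i = (if i < l then int d - int (count (mset (map snd L)) (Suc i))
              else int (count (mset (map fst L)) (i - l)))"

text \<open>
  The change of the row occupancies under \<open>E b a\<close>.
\<close>
definition shift :: "nat \<Rightarrow> nat \<Rightarrow> nat \<Rightarrow> int" where
  "shift b a i = of_bool (i = b) - of_bool (i = a)"

text \<open>
  The number \<open>z\<close> of letters \<open>0\<close> is recorded separately, since moving particles cannot change it.
\<close>
definition words_of :: "(nat \<Rightarrow> int) \<Rightarrow> nat \<Rightarrow> (nat \<times> nat) list set" where
  "words_of r z = {L. (\<forall>x\<in>set (map snd L). x \<le> l) \<and> occ L = r \<and> count (mset (map snd L)) 0 = z}"

lemma occ_Cons: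
  "occ (p # L) i = occ L i + (if i < l then - of_bool (snd p = Suc i) else of_bool (fst p = i - l))"
  by (simp add: occ_def)

lemma letter_op_span:
  assumes "y \<in> fock.span S"
  shows "letter_op p y \<in> fock.span (letter_op p ` S)"
proof -
  obtain t c where tc: "finite t" "t \<subseteq> S" "y = (\<Sum>v\<in>t. fscale (c v) v)"
    using assms unfolding fock.span_explicit by blast
  show ?thesis
    unfolding tc(3) letter_op_sum letter_op_linear
    by (intro fock.span_sum fock.span_scale fock.span_base) (use tc(2) in auto)
qed

text \<open>
  \<open>E b a\<close> acts on a product of letters as a derivation: it moves the position of a letter or the
  row from which a particle is taken.
\<close>
lemma E_letter_op:
  "E b a (letter_op (q, x) y) = letter_op (q, x) (E b a y) +
    (if x = 0 then (if a = l + q then create (mode b 0) y else 0)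
     else (if a = l + q then E b (x - 1) y else 0) - (if b = x - 1 then E (l + q) a y else 0))"
  using E_create[OF d_pos] E_commute[of b a "l + q" "x - 1"] by (simp add: letter_op_def)

lemma E_ket_full:
  assumes "a \<noteq> b" "a < l \<longrightarrow> b < l"
  shows "E b a (ket {..<l * d}) = 0"
proof -
  have none: "\<not> (mode a c \<in> {..<l * d} \<and> mode b c \<notin> {..<l * d} - {mode a c})" if c: "c < d" for c
  proof
    assume *: "mode a c \<in> {..<l * d} \<and> mode b c \<notin> {..<l * d} - {mode a c}"
    then have "a < l"
      by (metis c lessThan_iff mode_div_mod(1) div_less_iff_less_mult d_pos)
    then show False
      using * assms mode_less[of b l c] mode_eq_iff[OF c c] c by auto
  qed
  show ?thesis
    unfolding E_ket by (intro sum.neutral ballI if_not_P none) simp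
qed

text \<open>
  Lowering keeps the span of the words stable. Between the full rows and the rest, at \<open>Suc t = l\<close>,
  it is itself a letter; elsewhere it annihilates the full rows and replaces single letters.
\<close>
lemma word_vec_lower:
  assumes "l \<ge> 1" "L \<in> words_of r z"
  shows "E (Suc t) t (word_vec L) \<in> fock.span (word_vec ` words_of (\<lambda>i. r i + shift (Suc t) t i) z)"
proof (cases "Suc t = l")
  case True
  have "letter_op (0, l) = E (Suc t) t"
  proof -
    have "l - Suc 0 = t" using True by simp
    then show ?thesis
      using assms(1) True by (simp add: letter_op_def)
  qed
  then have "E (Suc t) t (word_vec L) = word_vec ((0, l) # L)"
    by (simp add: word_vec_def)
  moreover have "(0, l) # L \<in> words_of (\<lambda>i. r i + shift (Suc t) t i) z"
  proof -
    have "shift (Suc t) t i = (if i < l then - of_bool (l = Suc i) else of_bool (0 = i - l))" for i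
      using True unfolding shift_def by auto
    then show ?thesis
      using assms by (simp add: words_of_def fun_eq_iff occ_Cons)
  qed
  ultimately show ?thesis
    by (intro fock.span_base) simp
next
  case tl: False
  show ?thesis
    using assms(2)
  proof (induction L arbitrary: r z)
    case Nil
    have zero: "E (Suc t) t (word_vec []) = 0"
      unfolding word_vec_def using tl by (simp add: E_ket_full)
    show ?case
      unfolding zero by (rule fock.span_zero)
  next
    case (Cons p L)
    obtain q x where p: "p = (q, x)" by (cases p)
    let ?R = "\<lambda>i. r i + shift (Suc t) t i"
    define r' where "r' = occ L"
    define z' where "z' = count (mset (map snd L)) 0"
    have L: "L \<in> words_of r' z'" and x: "x \<le> l"
      using Cons.prems by (auto simp: words_of_def r'_def z'_def p)
    have r: "r i = r' i + (if i < l then - of_bool (x = Suc i) else of_bool (q = i - l))" for i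
      using Cons.prems by (auto simp: words_of_def r'_def p occ_Cons)
    have z: "z = z' + of_bool (x = 0)"
      using Cons.prems by (auto simp: words_of_def z'_def p)
    have mem: "(q', x') # L' \<in> words_of ?R z"
      if "L' \<in> words_of r'' z'" "x' \<le> l" "x = 0 \<longleftrightarrow> x' = 0"
        "\<And>i. ?R i = r'' i + (if i < l then - of_bool (x' = Suc i) else of_bool (q' = i - l))"
      for q' x' L' r''
      using that z by (auto simp: words_of_def fun_eq_iff occ_Cons)
    have same: "letter_op p ` word_vec ` words_of (\<lambda>i. r' i + shift (Suc t) t i) z' \<subseteq>
        word_vec ` words_of ?R z"
    proof -
      have "p # L' \<in> words_of ?R z" if "L' \<in> words_of (\<lambda>i. r' i + shift (Suc t) t i) z'" for L'
        unfolding p by (rule mem[OF that x refl]) (simp add: r)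
      then show ?thesis
        by (force simp: word_vec_def image_iff)
    qed
    have first: "letter_op p (E (Suc t) t (word_vec L)) \<in> fock.span (word_vec ` words_of ?R z)"
      using fock.span_mono[OF same] letter_op_span[OF Cons.IH[OF L]] by blast
    have new: "letter_op (q', x') (word_vec L) \<in> fock.span (word_vec ` words_of ?R z)"
      if "(q', x') # L \<in> words_of ?R z" for q' x'
    proof -
      have "letter_op (q', x') (word_vec L) = word_vec ((q', x') # L)"
        by (simp add: word_vec_def)
      then show ?thesis
        using that by (metis fock.span_base imageI)
    qed
    let ?corr = "if x = 0 then (if t = l + q then create (mode (Suc t) 0) (word_vec L) else 0)
      else (if t = l + q then E (Suc t) (x - 1) (word_vec L) else 0) -
        (if Suc t = x - 1 then E (l + q) t (word_vec L) else 0)"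
    have "?corr \<in> fock.span (word_vec ` words_of ?R z)"
    proof (cases "t = l + q")
      case True
      have "(Suc q, x) # L \<in> words_of ?R z"
      proof (rule mem[OF L x refl])
        fix i
        have "shift (Suc t) t i = (if i < l then 0 else of_bool (Suc q = i - l) - of_bool (q = i - l))"
        proof (cases "i < l")
          case False
          then obtain j where "i = l + j" using le_Suc_ex by (metis not_less)
          then show ?thesis using True by (simp add: shift_def eq_commute)
        qed (simp add: True shift_def)
        then show "?R i = r' i + (if i < l then - of_bool (x = Suc i) else of_bool (Suc q = i - l))"
          by (simp add: r)
      qed
      then have "letter_op (Suc q, x) (word_vec L) \<in> fock.span (word_vec ` words_of ?R z)"
        by (rule new)
      moreover have "Suc t \<noteq> x - 1" using True x by simp
      then have "?corr = letter_op (Suc q, x) (word_vec L)"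
        using True by (simp add: letter_op_def)
      ultimately show ?thesis by simp
    next
      case False
      show ?thesis
      proof (cases "x \<noteq> 0 \<and> Suc t = x - 1")
        case True
        have "(q, Suc t) # L \<in> words_of ?R z"
        proof (rule mem[OF L])
          fix i
          have "shift (Suc t) t i = of_bool (x = Suc i) - of_bool (Suc t = Suc i)" "i < l \<or> x \<noteq> Suc i \<and> t \<noteq> i"
            using True x by (auto simp: shift_def of_bool_def)
          then show "?R i = r' i + (if i < l then - of_bool (Suc t = Suc i) else of_bool (q = i - l))"
            by (auto simp: r)
        qed (use True x in auto)
        then have "letter_op (q, Suc t) (word_vec L) \<in> fock.span (word_vec ` words_of ?R z)"
          by (rule new)
        moreover have "letter_op (q, Suc t) (word_vec L) = E (l + q) t (word_vec L)"
          by (simp add: letter_op_def)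
        then have "?corr = - letter_op (q, Suc t) (word_vec L)"
          using True False by simp
        ultimately show ?thesis
          using fock.span_neg by simp
      next
        case other: False
        then have zero: "?corr = 0" using False by auto
        show ?thesis unfolding zero by (rule fock.span_zero)
      qed
    qed
    moreover have vec: "word_vec ((q, x) # L) = letter_op (q, x) (word_vec L)"
      by (simp add: word_vec_def)
    have eq: "E (Suc t) t (word_vec (p # L)) = letter_op p (E (Suc t) t (word_vec L)) + ?corr"
      unfolding p vec by (rule E_letter_op)
    ultimately show ?case
      unfolding eq by (intro fock.span_add first)
  qed
qed

section \<open>Shuffles\<close>

text \<open>
  Each of the first \<open>l\<close> rows has lost one particle, and each of the remaining rows has one.
\<close>
definition target_occ :: "nat \<Rightarrow> int" where
  "target_occ i = (if i < l then int k else of_bool (i < num_rows))"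

text \<open>
  The same configuration as \<open>conf\<close>, for a shuffle given by the list \<open>b\<close> of the colours of its
  letters. Shuffles with the same coloured pattern have the same configuration.
\<close>
definition conf_of :: "(nat \<Rightarrow> nat) \<Rightarrow> nat list \<Rightarrow> nat set" where
  "conf_of a b = {z. if z div d < l then a (Suc (z div d)) \<noteq> z mod d
     else z div d - l < length b \<and> b ! (z div d - l) = z mod d}"

definition shuffle_vec :: "nat list \<Rightarrow> fock" where
  "shuffle_vec w =
    (\<Sum>a\<in>colourings {1..l}. fscale (colour_sign a) (ket (conf_of a (map a w))))"

lemma shuffle_props:
  assumes "w \<in> shuffles_of s l"
  shows "length w = l + s" "set w - {0} = {1..l}" "\<And>x. x \<in> set w \<Longrightarrow> x \<le> l"
    "distinct (filter (\<lambda>x. x \<noteq> 0) w)" "count (mset w) 0 = s"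
proof -
  have w: "mset w = replicate_mset s 0 + mset [1..<l + 1]"
    using assms by (simp add: shuffles_of_def)
  show "length w = l + s"
    using arg_cong[OF w, of size] by simp
  have "set_mset (mset w) = set_mset (replicate_mset s 0 + mset [1..<l + 1])"
    unfolding w ..
  then have set: "set w = (if s = 0 then {} else {0}) \<union> {1..<l + 1}"
    by (simp only: set_mset_union set_mset_mset set_mset_replicate_mset_subset set_upt)
  show "set w - {0} = {1..l}"
    unfolding set by (cases "s = 0") auto
  show "x \<le> l" if "x \<in> set w" for x
    using that unfolding set by (cases "s = 0") auto
  have "mset (filter (\<lambda>x. x \<noteq> 0) w) = filter_mset (\<lambda>x. x \<noteq> 0) (mset w)"
    by simp
  also have "\<dots> = mset [1..<l + 1]"
    unfolding w by (auto simp: multiset_eq_iff)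
  finally show "distinct (filter (\<lambda>x. x \<noteq> 0) w)"
    using mset_eq_imp_distinct_iff distinct_upt by blast
  show "count (mset w) 0 = s"
    unfolding w by (simp add: count_mset)
qed

lemma finite_shuffles: "finite (shuffles_of s l)"
proof -
  have "finite {w. set w \<subseteq> {..l} \<and> length w = l + s}"
    by (rule finite_lists_length_eq) simp
  then show ?thesis
    by (rule finite_subset[rotated]) (use shuffle_props(1,3) in auto)
qed

lemma shuffle_vec_eq:
  assumes "w \<in> shuffles_of s l"
  shows "conf_sum (set (zip [0..<l + s] w)) = shuffle_vec w"
proof -
  note w = shuffle_props[OF assms]
  have snd: "snd ` set (zip [0..<l + s] w) = set w"
    using w(1) by (metis length_upt map_snd_zip minus_nat.diff_0 set_map)
  have "conf a (set (zip [0..<l + s] w)) = conf_of a (map a w)" for a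
  proof -
    have "Suc i \<in> set w" if "i < l" for i
      using w(2) that by (metis DiffD1 Suc_leI atLeastAtMost_iff le_add1 plus_1_eq_Suc)
    moreover have "(\<exists>x. (q, x) \<in> set (zip [0..<l + s] w) \<and> a x = c) \<longleftrightarrow>
        q < length w \<and> map a w ! q = c" for q c
    proof -
      have "(q, x) \<in> set (zip [0..<l + s] w) \<longleftrightarrow> q < l + s \<and> x = w ! q" for x
        using w(1) by (auto simp: in_set_zip intro!: exI[of _ q])
      then show ?thesis using w(1) by auto
    qed
    ultimately show ?thesis
      unfolding conf_def conf_of_def snd by auto
  qed
  then show ?thesis
    by (simp add: conf_sum_def shuffle_vec_def snd w(2))
qed

lemma conf_of_inject:
  assumes a: "a \<in> colourings {1..l}" "a' \<in> colourings {1..l}"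
    and b: "set b \<subseteq> {..<d}" "set b' \<subseteq> {..<d}" "length b = length b'"
    and eq: "conf_of a b = conf_of a' b'"
  shows "a = a'" "b = b'"
proof -
  have mem: "mode i c \<in> conf_of a b \<longleftrightarrow> mode i c \<in> conf_of a' b'" for i c
    using eq by simp
  have "a x = a' x" for x
  proof (cases "x \<in> {1..l}")
    case True
    then show ?thesis
      using mem[of "x - 1" "a x"] colourings_less[OF a(1), of x]
      by (auto simp: conf_of_def mode_div_mod split: if_splits)
  next
    case False
    then show ?thesis using a colourings_zero by metis
  qed
  then show "a = a'" by blast
  show "b = b'"
  proof (rule nth_equalityI)
    fix i assume i: "i < length b"
    then have "b ! i < d" using b(1) nth_mem by blast
    then show "b ! i = b' ! i"
      using mem[of "l + i" "b ! i"] i by (auto simp: conf_of_def mode_div_mod)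
  qed (rule b(3))
qed

lemma shuffle_vec_apply:
  assumes "a \<in> colourings {1..l}" "w \<in> shuffles_of s l" "w' \<in> shuffles_of s l"
  shows "shuffle_vec w' (conf_of a (map a w)) = (if map a w' = map a w then colour_sign a else 0)"
proof -
  have apply_sum: "(\<Sum>i\<in>I. g i) S = (\<Sum>i\<in>I. g i S)" for I :: "(nat \<Rightarrow> nat) set" and g :: "_ \<Rightarrow> fock" and S :: "nat set"
    by (rule additive.sum[of "\<lambda>y. y S"]) (simp add: additive_def)
  have "fscale (colour_sign a') (ket (conf_of a' (map a' w'))) (conf_of a (map a w)) =
      (if a' = a then if map a w' = map a w then colour_sign a else 0 else 0)"
    if a': "a' \<in> colourings {1..l}" for a'
  proof -
    have "conf_of a (map a w) = conf_of a' (map a' w') \<longleftrightarrow> a' = a \<and> map a w' = map a w"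
    proof
      assume eq: "conf_of a (map a w) = conf_of a' (map a' w')"
      have "set (map a w) \<subseteq> {..<d}" "set (map a' w') \<subseteq> {..<d}"
        using colourings_less[OF assms(1)] colourings_less[OF a'] by auto
      moreover have "length (map a w) = length (map a' w')"
        using shuffle_props(1)[OF assms(2)] shuffle_props(1)[OF assms(3)] by simp
      ultimately show "a' = a \<and> map a w' = map a w"
        using conf_of_inject[OF assms(1) a' _ _ _ eq] by metis
    qed simp
    then show ?thesis by (auto simp: fscale_def ket_def)
  qed
  then show ?thesis
    using assms(1) finite_colourings[of "{1..l}"]
    by (simp add: shuffle_vec_def apply_sum)
qed

abbreviation avoiders :: "nat list set" where
  "avoiders \<equiv> {w \<in> shuffles_of s l. \<not> has_decreasing_subseq (k + 2) w}"

lemma shuffle_vec_in_span_avoiders: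
  assumes "w \<in> shuffles_of s l"
  shows "shuffle_vec w \<in> fock.span (shuffle_vec ` avoiders)"
proof -
  have "avoiders =
      {w. mset w = replicate_mset s 0 + mset [1..<l + 1] \<and> \<not> has_decreasing_subseq (k + 2) w}"
    by (simp add: shuffles_of_def)
  then show ?thesis
    using fock.colour_sum_in_span_avoiders[where A = "colourings {1..l}" and k = k and w = w and
        K = "\<lambda>a b. fscale (colour_sign a) (ket (conf_of a b))" and
        M = "replicate_mset s 0 + mset [1..<l + 1]"]
      colourings_less finite_shuffles assms
    unfolding shuffle_vec_def[abs_def] shuffles_of_def d_def by simp
qed

lemma colouring_of_avoider:
  assumes "w \<in> avoiders"
  obtains a where "a \<in> colourings {1..l}"
    "\<And>i j. i < j \<Longrightarrow> j < length w \<Longrightarrow> a (w ! i) = a (w ! j) \<Longrightarrow> w ! i \<le> w ! j"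
proof -
  have w: "w \<in> shuffles_of s l" using assms by simp
  obtain c where c: "\<And>i. i < length w \<Longrightarrow> c i < d" "\<And>i. i < length w \<Longrightarrow> w ! i = 0 \<Longrightarrow> c i = 0"
    "\<And>i j. i < j \<Longrightarrow> j < length w \<Longrightarrow> c i = c j \<Longrightarrow> w ! i \<le> w ! j"
    using greedy_colouring[of k w] assms unfolding d_def by blast
  define pos where "pos x = (SOME i. i < length w \<and> w ! i = x)" for x
  have pos: "pos x < length w \<and> w ! pos x = x" if "x \<in> set w" for x
    unfolding pos_def by (rule someI_ex) (use that in \<open>simp add: in_set_conv_nth\<close>)
  have uniq: "i = j" if "i < length w" "j < length w" "w ! i = w ! j" "w ! i \<noteq> 0" for i j
  proof (rule ccontr)
    assume "i \<noteq> j"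
    have "card {i, j} \<le> card {m. m < length w \<and> w ! m = w ! i}"
      by (rule card_mono) (use that in auto)
    then have "2 \<le> count (mset w) (w ! i)"
      using \<open>i \<noteq> j\<close> by (simp add: count_mset count_list_eq_length_filter length_filter_conv_card eq_commute)
    moreover have "count (mset w) (w ! i) = count (mset (filter (\<lambda>x. x \<noteq> 0) w)) (w ! i)"
      using that(4) by simp
    moreover have "\<dots> \<le> 1"
      using shuffle_props(4)[OF w] by (metis distinct_count_atmost_1 less_or_eq_imp_le order_refl le_numeral_extra(4) zero_le_one)
    ultimately show False by simp
  qed
  define a where "a x = (if x \<in> {1..l} then c (pos x) else 0)" for x
  have a: "a (w ! i) = c i" if i: "i < length w" for i
  proof (cases "w ! i = 0")
    case True
    then show ?thesis using c(2)[OF i] by (simp add: a_def)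
  next
    case False
    then have "w ! i \<in> set w - {0}"
      using i nth_mem by simp
    then have "w ! i \<in> {1..l}"
      unfolding shuffle_props(2)[OF w] .
    moreover have "pos (w ! i) = i"
      using pos[of "w ! i"] uniq[of i "pos (w ! i)"] i False by simp
    ultimately show ?thesis by (simp add: a_def)
  qed
  show ?thesis
  proof (rule that)
    show "a \<in> colourings {1..l}"
    proof -
      have "c (pos x) < d" if "x \<in> {1..l}" for x
        using c(1) pos[of x] that unfolding shuffle_props(2)[OF w, symmetric] by blast
      then show ?thesis by (simp add: colourings_def a_def)
    qed
    show "w ! i \<le> w ! j" if "i < j" "j < length w" "a (w ! i) = a (w ! j)" for i j
      using c(3) that a by simp
  qed
qed

text \<open>
  For the lexicographically largest word \<open>v\<close> with a nonzero coefficient, take the coefficient of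
  the configuration given by a monotone colouring of \<open>v\<close>: only words that are not smaller
  than \<open>v\<close> contribute to it.
\<close>
lemma avoiders_independent:
  assumes zero: "(\<Sum>w\<in>avoiders. fscale (c w) (shuffle_vec w)) = 0" and w: "w \<in> avoiders"
  shows "c w = 0"
proof (rule ccontr)
  assume "c w \<noteq> 0"
  let ?S = "{w \<in> avoiders. c w \<noteq> 0}"
  have fin: "finite avoiders" using finite_shuffles by simp
  have "finite ?S"
    by (rule finite_subset[OF _ fin]) blast
  moreover have "?S \<noteq> {}"
    using w \<open>c w \<noteq> 0\<close> by blast
  ultimately obtain v where v: "v \<in> ?S" "\<And>v'. v' \<in> ?S \<Longrightarrow> v' \<le> v"
    using Max_in[of ?S] Max_ge[of ?S] by blast
  obtain a where a: "a \<in> colourings {1..l}"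
    "\<And>i j. i < j \<Longrightarrow> j < length v \<Longrightarrow> a (v ! i) = a (v ! j) \<Longrightarrow> v ! i \<le> v ! j"
    using colouring_of_avoider[of v] v(1) by blast
  have apply_sum: "(\<Sum>i\<in>I. g i) S = (\<Sum>i\<in>I. g i S)" for I :: "nat list set" and g :: "_ \<Rightarrow> fock" and S :: "nat set"
    by (rule additive.sum[of "\<lambda>y. y S"]) (simp add: additive_def)
  have coeff: "c v' * shuffle_vec v' (conf_of a (map a v)) = (if v' = v then c v * colour_sign a else 0)"
    if v': "v' \<in> avoiders" for v'
  proof (cases "c v' = 0 \<or> map a v' \<noteq> map a v")
    case True
    then show ?thesis
      using v(1) v' a(1) by (auto simp: shuffle_vec_apply)
  next
    case False
    have "mset v = mset v'"
      using v(1) v' by (simp add: shuffles_of_def)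
    then have "v \<le> v'"
      using monotone_colouring_lex_min[of v v' a] a(2) False by simp
    moreover have "v' \<le> v"
      using v(2) v' False by simp
    ultimately have "v' = v" by simp
    then show ?thesis
      using v(1) a(1) by (simp add: shuffle_vec_apply)
  qed
  have "0 = (\<Sum>v'\<in>avoiders. c v' * shuffle_vec v' (conf_of a (map a v)))"
    using arg_cong[OF zero, of "\<lambda>y. y (conf_of a (map a v))"] by (simp add: apply_sum fscale_def)
  also have "\<dots> = (\<Sum>v'\<in>avoiders. if v' = v then c v * colour_sign a else 0)"
    using coeff by (rule sum.cong[OF refl])
  also have "\<dots> = c v * colour_sign a"
    using fin v(1) by simp
  finally show False
    using v(1) by (simp add: colour_sign_def)
qed

text \<open>
  The target occupancies force every nonzero letter and every position to occur exactly once, so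
  that the pairs of \<open>L\<close>, in any order, are the graph of a shuffle.
\<close>
lemma word_vec_target:
  assumes "L \<in> words_of target_occ s"
  shows "\<exists>g w. g \<noteq> 0 \<and> w \<in> shuffles_of s l \<and> word_vec L = fscale g (shuffle_vec w)"
proof -
  have le: "\<forall>x\<in>set (map snd L). x \<le> l" and occ: "occ L = target_occ"
    and zeros: "count (mset (map snd L)) 0 = s"
    using assms by (auto simp: words_of_def)
  have letters: "mset (map snd L) = replicate_mset s 0 + mset [1..<l + 1]"
  proof (rule multiset_eqI)
    fix x
    show "count (mset (map snd L)) x = count (replicate_mset s 0 + mset [1..<l + 1]) x"
    proof (cases "x = 0")
      case True
      have "count (mset [1..<l + 1]) 0 = 0"
        by (subst count_eq_zero_iff) simp
      then show ?thesis using zeros True by simp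
    next
      case False
      have 1: "count (mset [1..<l + 1]) x = of_bool (x \<in> set [1..<l + 1])"
        by (simp add: distinct_count_atmost_1[THEN iffD1, rule_format])
      show ?thesis
      proof (cases "x \<le> l")
        case True
        obtain y where y: "x = Suc y" using False by (cases x) auto
        have "count (mset (map snd L)) x = 1"
          using fun_cong[OF occ, of y] True y by (simp add: occ_def target_occ_def d_def)
        then show ?thesis using 1 True False by simp
      next
        case out: False
        then have "x \<notin> set (map snd L)" using le by auto
        then have "count (mset (map snd L)) x = 0" by (metis count_eq_zero_iff set_mset_mset)
        then show ?thesis using 1 out False by simp
      qed
    qed
  qed
  define ps where "ps = map fst L"
  have count: "count (mset ps) q = of_bool (q < l + s)" for q
    using fun_cong[OF occ, of "l + q"]
    by (cases "q < l + s") (simp_all add: occ_def target_occ_def mult_2 ps_def)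
  have "q \<in> set ps \<longleftrightarrow> q < l + s" for q
    using count[of q] count_eq_zero_iff[of "mset ps" q] by (cases "q < l + s") auto
  then have "distinct ps" "set ps = {..<l + s}"
    using count by (auto simp: distinct_count_atmost_1)
  then have positions: "distinct (map fst L)" "set (map fst L) = {..<l + s}"
    by (simp_all only: ps_def)
  define w where "w = map (\<lambda>q. the (map_of L q)) [0..<l + s]"
  have "set (zip [0..<l + s] w) = set L"
  proof -
    have "(q, x) \<in> set L \<longleftrightarrow> q < l + s \<and> x = the (map_of L q)" for q x
    proof
      assume "(q, x) \<in> set L"
      then show "q < l + s \<and> x = the (map_of L q)"
        using positions by (force simp: map_of_is_SomeI)
    next
      assume *: "q < l + s \<and> x = the (map_of L q)"
      then have "q \<in> fst ` set L" using positions(2) by auto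
      then obtain x' where "(q, x') \<in> set L" by auto
      then show "(q, x) \<in> set L"
        using * positions(1) by (simp add: map_of_is_SomeI)
    qed
    moreover have "zip [0..<l + s] w = map (\<lambda>q. (q, the (map_of L q))) [0..<l + s]"
      by (rule nth_equalityI) (simp_all add: w_def)
    ultimately show ?thesis by auto
  qed
  moreover have "mset (zip [0..<l + s] w) = mset L"
    using calculation positions(1)
    by (intro set_eq_iff_mset_eq_distinct[THEN iffD1]) (auto simp: distinct_zipI1 distinct_map)
  then have "mset w = mset (map snd L)"
    by (metis (no_types, lifting) length_map map_snd_zip mset_map w_def)
  then have w: "w \<in> shuffles_of s l"
    using letters by (simp add: shuffles_of_def)
  moreover have "distinct (filter (\<lambda>x. x \<noteq> 0) (map snd L))"
    using shuffle_props(4)[OF w] \<open>mset w = mset (map snd L)\<close>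
    by (metis mset_eq_imp_distinct_iff mset_filter)
  ultimately show ?thesis
    using word_vec_eq_conf_sum[of L] positions(1) le shuffle_vec_eq[OF w] by auto
qed

text \<open>
  The full rows together with particles in column \<open>0\<close> at the positions \<open>Z\<close>.
\<close>
definition base :: "nat set \<Rightarrow> nat set" where
  "base Z = conf (\<lambda>_. 0) ((\<lambda>q. (q, 0)) ` Z)"

definition base_occ :: "nat set \<Rightarrow> nat \<Rightarrow> int" where
  "base_occ Z i = (if i < l then int d else of_bool (i - l \<in> Z))"

lemma mode_in_base: "c < d \<Longrightarrow> mode r c \<in> base Z \<longleftrightarrow> r < l \<or> (c = 0 \<and> r - l \<in> Z)"
  by (auto simp: base_def mode_in_conf)

lemma base_subset:
  assumes "Z \<subseteq> {..<l + s}"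
  shows "base Z \<subseteq> {..<num_rows * d}"
proof
  fix z assume "z \<in> base Z"
  then have "z div d < l \<or> z div d - l \<in> Z"
    by (auto simp: base_def conf_def split: if_splits)
  then have "z div d < num_rows" using assms by auto
  then show "z \<in> {..<num_rows * d}"
    by (simp add: div_less_iff_less_mult[OF d_pos])
qed

lemma word_vec_zeros:
  assumes "distinct zs"
  shows "\<exists>g. g \<noteq> 0 \<and> word_vec (map (\<lambda>q. (q, 0)) zs) = fscale g (ket (base (set zs)))"
proof -
  let ?L = "map (\<lambda>q. (q, 0)) zs"
  have "colourings {} = {\<lambda>_. 0}" by (auto simp: colourings_def)
  moreover have snd: "snd ` set ?L - {0} = {}" by auto
  ultimately have "conf_sum (set ?L) = ket (base (set zs))"
    unfolding conf_sum_def snd by (simp add: colour_sign_def base_def)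
  moreover have "filter (\<lambda>x. x \<noteq> 0) (map snd ?L) = []"
    by (simp add: filter_empty_conv)
  then have "\<exists>g. g \<noteq> 0 \<and> word_vec ?L = fscale g (conf_sum (set ?L))"
    using assms by (intro word_vec_eq_conf_sum) (auto simp: comp_def distinct_map)
  ultimately show ?thesis by simp
qed

text \<open>
  A particle in row \<open>Suc t\<close> always has one in row \<open>t\<close> of the same column, which blocks it.
\<close>
lemma E_raise_base:
  assumes "\<And>q. Suc q \<in> Z \<Longrightarrow> q \<in> Z"
  shows "E t (Suc t) (ket (base Z)) = 0"
proof -
  have none: "\<not> (mode (Suc t) c \<in> base Z \<and> mode t c \<notin> base Z - {mode (Suc t) c})" if "c < d" for c
    using that assms[of "t - l"]
    by (auto simp: mode_in_base mode_eq_iff Suc_diff_le not_less)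
  show ?thesis
    unfolding E_ket by (intro sum.neutral ballI if_not_P none) simp
qed

lemma E_diag_ket: "E u u (ket S) = fscale (of_nat (card {c. c < d \<and> mode u c \<in> S})) (ket S)"
proof -
  have one: "fscale 1 y = y" for y by (simp add: fscale_def)
  have "E u u (ket S) = (\<Sum>c<d. if mode u c \<in> S then ket S else 0)"
    unfolding E_ket by (intro sum.cong refl) (auto simp: jw_sign_remove jw_sign_square one insert_absorb)
  also have "\<dots> = (\<Sum>c | c < d \<and> mode u c \<in> S. ket S)"
    by (subst sum.inter_filter[symmetric]) (auto intro!: sum.cong)
  also have "\<dots> = fscale (of_nat (card {c. c < d \<and> mode u c \<in> S})) (ket S)"
    by (simp add: fscale_def fun_eq_iff additive.sum[of "\<lambda>y. y T" for T] additive_def)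
  finally show ?thesis .
qed

lemma E_diag_base: "E u u (ket (base Z)) = fscale (of_int (base_occ Z u)) (ket (base Z))"
proof -
  have "{c. c < d \<and> mode u c \<in> base Z} = (if u < l then {..<d} else if u - l \<in> Z then {0} else {})"
    using d_pos by (auto simp: mode_in_base)
  then show ?thesis by (simp add: E_diag_ket base_occ_def)
qed

lemma E_lower_base:
  assumes q: "q \<in> Z" "Suc q \<notin> Z"
  shows "\<exists>g. g \<noteq> 0 \<and> E (Suc (l + q)) (l + q) (ket (base Z)) =
    fscale g (ket (base (insert (Suc q) (Z - {q}))))"
proof -
  let ?a = "mode (l + q) 0" and ?b = "mode (Suc (l + q)) 0"
  let ?g = "jw_sign ?a (base Z) * jw_sign ?b (base Z - {?a})"
  have in_iff: "mode (l + q) c \<in> base Z \<and> mode (Suc (l + q)) c \<notin> base Z - {mode (l + q) c} \<longleftrightarrow> c = 0"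
    if "c < d" for c
    using that q by (auto simp: mode_in_base Suc_diff_le)
  have "E (Suc (l + q)) (l + q) (ket (base Z)) =
      (\<Sum>c<d. if c = 0 then fscale ?g (ket (insert ?b (base Z - {?a}))) else 0)"
    unfolding E_ket by (intro sum.cong refl) (simp only: lessThan_iff in_iff, simp)
  also have "\<dots> = fscale ?g (ket (insert ?b (base Z - {?a})))"
    using d_pos by simp
  also have "insert ?b (base Z - {?a}) = base (insert (Suc q) (Z - {q}))"
  proof (intro Set.set_eqI)
    fix z
    have z: "z = mode r 0 \<longleftrightarrow> z div d = r \<and> z mod d = 0" for r
      using d_pos by (metis mode_div_mod div_mult_mod_eq mode_def)
    have zz: "z = mode (z div d) (z mod d)" by (simp add: mode_def)
    have base: "z \<in> base Y \<longleftrightarrow> z div d < l \<or> (z mod d = 0 \<and> z div d - l \<in> Y)" for Y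
      using mode_in_base[of "z mod d" "z div d" Y] d_pos zz by simp
    show "z \<in> insert ?b (base Z - {?a}) \<longleftrightarrow> z \<in> base (insert (Suc q) (Z - {q}))"
      unfolding insert_iff Diff_iff empty_iff base z by auto
  qed
  finally show ?thesis
    by (intro exI[of _ ?g]) (simp add: jw_sign_nonzero)
qed

lemma occ_shuffle:
  assumes "w \<in> shuffles_of s l"
  shows "occ (zip [0..<l + s] w) = target_occ"
proof
  fix i
  note w = shuffle_props[OF assms]
  have snd: "map snd (zip [0..<l + s] w) = w" and fst: "map fst (zip [0..<l + s] w) = [0..<l + s]"
    using w(1) by simp_all
  have upt: "count (mset [0..<l + s]) q = of_bool (q < l + s)" for q
    by (simp add: distinct_count_atmost_1[THEN iffD1, rule_format])
  have one: "count (mset w) (Suc i) = 1" if "i < l"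
  proof -
    have "mset w = replicate_mset s 0 + mset [1..<l + 1]"
      using assms by (simp add: shuffles_of_def)
    then show ?thesis
      using that by (simp add: distinct_count_atmost_1[THEN iffD1, rule_format])
  qed
  show "occ (zip [0..<l + s] w) i = target_occ i"
    unfolding occ_def target_occ_def snd fst upt using one by (auto simp: d_def)
qed

end

section \<open>Highest weight modules\<close>

locale highest_weight_rep =
  kac_moody_module scale bracket n A h coroot root e f vscale act
  for scale :: "complex \<Rightarrow> 'g::ab_group_add \<Rightarrow> 'g"
    and bracket :: "'g \<Rightarrow> 'g \<Rightarrow> 'g"
    and n :: nat
    and A :: "nat \<Rightarrow> nat \<Rightarrow> int"
    and h :: "'g set"
    and coroot :: "nat \<Rightarrow> 'g"
    and root :: "nat \<Rightarrow> 'g \<Rightarrow> complex"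
    and e f :: "nat \<Rightarrow> 'g"
    and vscale :: "complex \<Rightarrow> 'v::ab_group_add \<Rightarrow> 'v"
    and act :: "'g \<Rightarrow> 'v \<Rightarrow> 'v" +
  fixes \<Lambda> :: "'g \<Rightarrow> complex" and v :: 'v
  assumes v_nonzero: "v \<noteq> 0"
    and n_plus_v: "x \<in> n_plus \<Longrightarrow> act x v = 0"
    and v_weight: "v \<in> weight_space \<Lambda>"
    and v_generates: "submodule hull {v} = UNIV"
begin

lemma act_add: "act x (y + z) = act x y + act x z"
  and act_vscale: "act x (vscale c y) = vscale c (act x y)"
  and act_zero: "act x 0 = 0"
  and act_sum: "act x (\<Sum>i\<in>I. g i) = (\<Sum>i\<in>I. act x (g i))"
proof -
  interpret L: Vector_Spaces.linear vscale vscale "act x"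
    by (rule act_linear_vector)
  show "act x (y + z) = act x y + act x z" "act x (vscale c y) = vscale c (act x y)"
    "act x 0 = 0"
    "act x (\<Sum>i\<in>I. g i) = (\<Sum>i\<in>I. act x (g i))"
    by (rule L.add L.scale L.zero L.sum)+
qed

lemma act_algebra_add: "act (x + y) z = act x z + act y z"
  and act_algebra_scale: "act (scale c x) z = vscale c (act x z)"
  and act_algebra_zero: "act 0 z = 0"
proof -
  interpret L: Vector_Spaces.linear scale vscale "\<lambda>x. act x z"
    by (rule act_linear_algebra)
  show "act (x + y) z = act x z + act y z" "act (scale c x) z = vscale c (act x z)" "act 0 z = 0"
    by (rule L.add L.scale L.zero)+
qed

lemma act_e_f:
  assumes "i < n" "j < n"
  shows "act (e i) (act (f j) x) = act (f j) (act (e i) x) + (if i = j then act (coroot i) x else 0)"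
  using act_bracket[of "e i" "f j" x] bracket_e_f[OF assms]
  by (auto simp: act_algebra_zero algebra_simps split: if_splits)

lemma act_h_f:
  assumes "y \<in> h" "i < n"
  shows "act y (act (f i) x) = act (f i) (act y x) - vscale (root i y) (act (f i) x)"
proof -
  have "act (bracket y (f i)) x = - vscale (root i y) (act (f i) x)"
    unfolding bracket_h_f[OF assms] act_algebra_scale by simp
  then show ?thesis
    using act_bracket[of y "f i" x] by (simp add: algebra_simps)
qed

lemma act_h_e:
  assumes "y \<in> h" "i < n"
  shows "act y (act (e i) x) = act (e i) (act y x) + vscale (root i y) (act (e i) x)"
  using act_bracket[of y "e i" x] bracket_h_e[OF assms]
  by (simp add: act_algebra_scale algebra_simps)

text \<open>The elements of \<open>\<gg>\<close> that preserve a given subspace form a subalgebra.\<close>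
lemma submoduleI:
  assumes W: "V.subspace W"
    and h: "\<And>y w. y \<in> h \<Longrightarrow> w \<in> W \<Longrightarrow> act y w \<in> W"
    and e: "\<And>i w. i < n \<Longrightarrow> w \<in> W \<Longrightarrow> act (e i) w \<in> W"
    and f: "\<And>i w. i < n \<Longrightarrow> w \<in> W \<Longrightarrow> act (f i) w \<in> W"
  shows "submodule W"
proof -
  let ?S = "{x. \<forall>w\<in>W. act x w \<in> W}"
  have "subalgebra ?S"
    unfolding subalgebra_def
  proof
    show "subspace ?S"
      by (rule subspaceI)
        (use W in \<open>auto simp: act_algebra_zero act_algebra_add act_algebra_scale
          V.subspace_0 V.subspace_add V.subspace_scale\<close>)
    show "\<forall>x\<in>?S. \<forall>y\<in>?S. bracket x y \<in> ?S"
      using W by (auto simp: act_bracket V.subspace_diff)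
  qed
  moreover have "h \<union> e ` {..<n} \<union> f ` {..<n} \<subseteq> ?S"
    using h e f by auto
  ultimately have "subalgebra hull (h \<union> e ` {..<n} \<union> f ` {..<n}) \<subseteq> ?S"
    by (intro hull_minimal)
  then have "?S = UNIV"
    using generated by auto
  then show ?thesis
    using W by (auto simp: submodule_def)
qed

definition lower :: "nat list \<Rightarrow> 'v" where
  "lower w = foldr (\<lambda>i. act (f i)) w v"

text \<open>
  The weight of a product of lowering operators with content \<open>m\<close> applied to \<open>v\<close>.
\<close>
definition wt :: "nat multiset \<Rightarrow> 'g \<Rightarrow> complex" where
  "wt m y = \<Lambda> y - (\<Sum>i<n. of_nat (count m i) * root i y)"

lemma lower_Nil: "lower [] = v" and lower_Cons: "lower (i # w) = act (f i) (lower w)"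
  by (simp_all add: lower_def)

lemma e_v: "i < n \<Longrightarrow> act (e i) v = 0"
proof (rule n_plus_v)
  assume "i < n"
  then show "e i \<in> n_plus"
    unfolding n_plus_def using hull_subset[of "e ` {..<n}" subalgebra] by auto
qed

lemma h_v: "y \<in> h \<Longrightarrow> act y v = vscale (\<Lambda> y) v"
  using v_weight by (simp add: weight_space_def)

lemma act_h_lower:
  assumes "y \<in> h" "set w \<subseteq> {..<n}"
  shows "act y (lower w) = vscale (wt (mset w) y) (lower w)"
  using assms(2)
proof (induction w)
  case Nil
  then show ?case by (simp add: lower_Nil h_v assms(1) wt_def)
next
  case (Cons j w)
  have "(\<Sum>i<n. of_nat (count (mset (j # w)) i) * root i y) =
      (\<Sum>i<n. of_nat (count (mset w) i) * root i y + (if i = j then root j y else 0))"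
    by (rule sum.cong) (auto simp: algebra_simps)
  also have "\<dots> = (\<Sum>i<n. of_nat (count (mset w) i) * root i y) + root j y"
    using Cons.prems by (simp add: sum.distrib)
  finally have "wt (mset (j # w)) y = wt (mset w) y - root j y"
    by (simp add: wt_def)
  then show ?case
    using Cons by (simp add: lower_Cons act_h_f assms(1) act_vscale V.scale_left_diff_distrib)
qed

lemma lower_weight: "set w \<subseteq> {..<n} \<Longrightarrow> lower w \<in> weight_space (wt (mset w))"
  by (simp add: weight_space_def act_h_lower)

lemma weight_space_subspace: "V.subspace (weight_space \<mu>)"
  by (rule V.subspaceI)
    (auto simp: weight_space_def act_zero act_add act_vscale V.scale_right_distrib V.scale_left_commute)

lemma span_lower_stable:
  assumes "V.subspace W" "\<And>w. w \<in> S \<Longrightarrow> act x (lower w) \<in> W" "y \<in> V.span (lower ` S)"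
  shows "act x y \<in> W"
proof -
  have "V.subspace {y. act x y \<in> W}"
    by (rule V.subspaceI)
      (use assms(1) in \<open>auto simp: act_zero act_add act_vscale
        V.subspace_0 V.subspace_add V.subspace_scale\<close>)
  then have "V.span (lower ` S) \<subseteq> {y. act x y \<in> W}"
    using assms(2) by (intro V.span_minimal) auto
  then show ?thesis using assms(3) by blast
qed

lemma e_lower:
  assumes "i < n" "set w \<subseteq> {..<n}"
  shows "act (e i) (lower w) \<in> V.span (lower ` {w. set w \<subseteq> {..<n}})" (is "_ \<in> ?V")
  using assms(2)
proof (induction w)
  case Nil
  then show ?case by (simp add: lower_Nil e_v assms(1) V.span_zero)
next
  case (Cons j w)
  have "act (f j) (act (e i) (lower w)) \<in> ?V"
  proof (rule span_lower_stable)
    show "act (e i) (lower w) \<in> ?V" using Cons by simp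
    show "act (f j) (lower u) \<in> ?V" if "u \<in> {w. set w \<subseteq> {..<n}}" for u
      unfolding lower_Cons[symmetric] using that Cons.prems by (intro V.span_base imageI) simp
  qed simp
  moreover have "act (coroot i) (lower w) \<in> ?V"
    using Cons.prems assms(1) coroot_in_h
    by (auto simp: act_h_lower intro: V.span_base V.span_scale)
  ultimately show ?case
    using Cons.prems assms(1) by (auto simp: lower_Cons act_e_f intro: V.span_add)
qed

text \<open>
  The span of the lowered vectors is a submodule: a raising operator is commuted to the right until
  it annihilates \<open>v\<close>, and the elements of \<open>h\<close> created on the way act by scalars.
\<close>
lemma span_lower: "V.span (lower ` {w. set w \<subseteq> {..<n}}) = UNIV" (is "?V = _")
proof -
  have "submodule ?V"
  proof (rule submoduleI)
    show "act y w \<in> ?V" if "y \<in> h" "w \<in> ?V" for y w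
      by (rule span_lower_stable[OF _ _ that(2)])
        (auto simp: act_h_lower that(1) intro: V.span_base V.span_scale)
    show "act (e i) w \<in> ?V" if "i < n" "w \<in> ?V" for i w
      by (rule span_lower_stable[OF _ _ that(2)]) (auto intro: e_lower that(1))
    show "act (f i) w \<in> ?V" if "i < n" "w \<in> ?V" for i w
      by (rule span_lower_stable[OF _ _ that(2)])
        (auto simp: lower_Cons[symmetric] that(1) intro: V.span_base)
  qed simp
  moreover have "lower [] \<in> ?V"
    by (rule V.span_base) auto
  then have "{v} \<subseteq> ?V" by (simp add: lower_Nil)
  ultimately have "submodule hull {v} \<subseteq> ?V"
    by (intro hull_minimal)
  then show ?thesis
    using v_generates by auto
qed

text \<open>
  Applying \<open>y - \<mu> j y\<close> with \<open>y \<in> h\<close> removes the \<open>j\<close>-th vector and multiplies every other one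
  by a factor that is nonzero for suitable \<open>y\<close>.
\<close>
lemma weight_vectors_independent:
  assumes "finite I" "\<And>i. i \<in> I \<Longrightarrow> u i \<in> weight_space (\<mu> i)"
    and "\<And>i j. i \<in> I \<Longrightarrow> j \<in> I \<Longrightarrow> i \<noteq> j \<Longrightarrow> \<exists>y\<in>h. \<mu> i y \<noteq> \<mu> j y"
    and "(\<Sum>i\<in>I. u i) = 0" and "i \<in> I"
  shows "u i = 0"
  using assms
proof (induction I arbitrary: u i rule: finite_induct)
  case empty
  then show ?case by simp
next
  case (insert j I)
  have other: "u i = 0" if i: "i \<in> I" for i
  proof -
    obtain y where y: "y \<in> h" "\<mu> i y \<noteq> \<mu> j y"
      using insert.prems(2)[of i j] i insert.hyps by auto
    have "0 = act y (\<Sum>i\<in>insert j I. u i) - vscale (\<mu> j y) (\<Sum>i\<in>insert j I. u i)"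
      by (simp only: insert.prems(3) act_zero V.scale_zero_right diff_zero)
    also have "\<dots> = (\<Sum>i\<in>insert j I. act y (u i) - vscale (\<mu> j y) (u i))"
      by (simp only: act_sum V.scale_sum_right sum_subtractf)
    also have "\<dots> = (\<Sum>i\<in>insert j I. vscale (\<mu> i y - \<mu> j y) (u i))"
      using insert.prems(1) y(1)
      by (intro sum.cong) (auto simp: weight_space_def V.scale_left_diff_distrib)
    also have "\<dots> = (\<Sum>i\<in>I. vscale (\<mu> i y - \<mu> j y) (u i))"
      using insert.hyps by simp
    finally have sum: "(\<Sum>i\<in>I. vscale (\<mu> i y - \<mu> j y) (u i)) = 0"
      by simp
    have "vscale (\<mu> i y - \<mu> j y) (u i) = 0"
    proof (rule insert.IH[OF _ _ sum i])
      show "vscale (\<mu> i y - \<mu> j y) (u i) \<in> weight_space (\<mu> i)" if "i \<in> I" for i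
        using insert.prems(1) that weight_space_subspace by (simp add: V.subspace_scale)
      show "\<exists>y\<in>h. \<mu> i y \<noteq> \<mu> j y" if "i \<in> I" "j \<in> I" "i \<noteq> j" for i j
        using insert.prems(2) that by simp
    qed
    then show ?thesis using y(2) by simp
  qed
  then have "u j = 0"
    using insert.prems(3) insert.hyps by simp
  then show ?case
    using other insert.prems(4) by auto
qed

lemma wt_inject:
  assumes m: "set_mset m \<subseteq> {..<n}" "set_mset m' \<subseteq> {..<n}" and "m \<noteq> m'"
  shows "\<exists>y\<in>h. wt m y \<noteq> wt m' y"
proof (rule ccontr)
  assume "\<not> (\<exists>y\<in>h. wt m y \<noteq> wt m' y)"
  then have "(\<Sum>i<n. (of_nat (count m i) - of_nat (count m' i)) * root i y) = 0" if "y \<in> h" for y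
    using that by (simp add: wt_def left_diff_distrib sum_subtractf)
  then have zero: "of_nat (count m i) - of_nat (count m' i) = (0::complex)" if "i < n" for i
    using root_independent[of "\<lambda>i. of_nat (count m i) - of_nat (count m' i)"] that by blast
  have "count m i = count m' i" for i
  proof (cases "i < n")
    case True
    then show ?thesis using zero[OF True] by simp
  next
    case False
    then have "i \<notin># m" "i \<notin># m'" using m by auto
    then show ?thesis by (metis count_inI)
  qed
  then show False
    using \<open>m \<noteq> m'\<close> by (auto intro: multiset_eqI)
qed

text \<open>
  A combination of lowered vectors of various contents that is a weight vector is equal to its
  component of that weight, since different contents have different weights.
\<close>
lemma weight_component:
  assumes S: "\<And>w. w \<in> S \<Longrightarrow> set w \<subseteq> {..<n}" and m: "set_mset m \<subseteq> {..<n}"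
    and x: "x \<in> V.span (lower ` S)" "x \<in> weight_space (wt m)"
  shows "x \<in> V.span (lower ` {w \<in> S. mset w = m})"
proof -
  obtain t r where t: "finite t" "t \<subseteq> lower ` S" and x_eq: "x = (\<Sum>a\<in>t. vscale (r a) a)"
    using x(1) unfolding V.span_explicit by blast
  define g where "g a = inv_into S lower a" for a
  have g: "g a \<in> S" "lower (g a) = a" if "a \<in> t" for a
    using that t(2) by (auto simp: g_def f_inv_into_f inv_into_into)
  define part where "part m' = (\<Sum>a | a \<in> t \<and> mset (g a) = m'. vscale (r a) a)" for m'
  let ?K = "insert m ((\<lambda>a. mset (g a)) ` t)"
  have fin: "finite ?K" using t(1) by simp
  have sum_part: "(\<Sum>m'\<in>?K. part m') = x"
    unfolding part_def x_eq using t(1) fin by (intro sum.group) auto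
  have part_weight: "part m' \<in> weight_space (wt m')" for m'
    unfolding part_def
  proof (intro V.subspace_sum V.subspace_scale weight_space_subspace)
    fix a assume "a \<in> {a \<in> t. mset (g a) = m'}"
    then show "a \<in> weight_space (wt m')"
      using lower_weight[of "g a"] g[of a] S by auto
  qed
  \<comment> \<open>Taking \<open>x\<close> away from the component of its own weight leaves components that sum to zero.\<close>
  let ?u = "\<lambda>m'. part m' - (if m' = m then x else 0)"
  have "?u m = 0"
  proof (rule weight_vectors_independent[of ?K ?u wt m])
    show "?u m' \<in> weight_space (wt m')" if "m' \<in> ?K" for m'
      using part_weight x(2) weight_space_subspace
      by (auto intro: V.subspace_diff)
    show "\<exists>y\<in>h. wt i y \<noteq> wt j y" if "i \<in> ?K" "j \<in> ?K" "i \<noteq> j" for i j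
    proof (rule wt_inject)
      show "set_mset i \<subseteq> {..<n}" "set_mset j \<subseteq> {..<n}"
        using that m g S by fastforce+
    qed (rule that(3))
    show "(\<Sum>m'\<in>?K. ?u m') = 0"
      using fin by (simp only: sum_subtractf sum_part) simp
  qed (use fin in auto)
  then have "x = part m" by simp
  also have "\<dots> \<in> V.span (lower ` {w \<in> S. mset w = m})"
    unfolding part_def
    by (intro V.span_sum V.span_scale V.span_base) (use g in \<open>force simp: image_iff\<close>)
  finally show ?thesis .
qed

lemma weight_space_eq_span:
  assumes "set_mset m \<subseteq> {..<n}"
  shows "weight_space (wt m) = V.span (lower ` {w. mset w = m})"
proof
  show "weight_space (wt m) \<subseteq> V.span (lower ` {w. mset w = m})"
  proof
    fix x assume "x \<in> weight_space (wt m)"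
    then have "x \<in> V.span (lower ` {w \<in> {w. set w \<subseteq> {..<n}}. mset w = m})"
      using span_lower assms by (intro weight_component) auto
    then show "x \<in> V.span (lower ` {w. mset w = m})"
      using V.span_mono[of "lower ` {w \<in> {w. set w \<subseteq> {..<n}}. mset w = m}" "lower ` {w. mset w = m}"]
      by blast
  qed
  show "V.span (lower ` {w. mset w = m}) \<subseteq> weight_space (wt m)"
  proof (intro V.span_minimal weight_space_subspace image_subsetI)
    fix w assume "w \<in> {w. mset w = m}"
    then have "mset w = m" "set w \<subseteq> {..<n}"
      using assms by (auto simp flip: set_mset_mset)
    then show "lower w \<in> weight_space (wt m)"
      using lower_weight by blast
  qed
qed

text \<open>
  A complement of the line spanned by \<open>v\<close>. A vector belongs to it if and only if its coefficient
  at \<open>v\<close> is zero, so it takes the place of that linear functional.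
\<close>
definition below_top :: "'v set" where
  "below_top = V.span (lower ` {w. w \<noteq> [] \<and> set w \<subseteq> {..<n}})"

lemma v_not_below_top: "v \<notin> below_top"
proof
  assume "v \<in> below_top"
  have "wt {#} = \<Lambda>" by (simp add: wt_def fun_eq_iff)
  then have "v \<in> V.span (lower ` {w \<in> {w. w \<noteq> [] \<and> set w \<subseteq> {..<n}}. mset w = {#}})"
    using \<open>v \<in> below_top\<close> v_weight by (intro weight_component) (auto simp: below_top_def)
  also have "{w \<in> {w. w \<noteq> [] \<and> set w \<subseteq> {..<n}}. mset w = {#}} = {}"
    by auto
  finally show False using v_nonzero by simp
qed

lemma f_below_top:
  assumes "i < n"
  shows "act (f i) x \<in> below_top"
proof -
  have "x \<in> V.span (lower ` {w. set w \<subseteq> {..<n}})" using span_lower by blast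
  then show ?thesis
    by (rule span_lower_stable[rotated 2])
      (auto simp: below_top_def lower_Cons[symmetric] assms intro!: V.span_base)
qed

lemma h_below_top: "y \<in> h \<Longrightarrow> x \<in> below_top \<Longrightarrow> act y x \<in> below_top"
  unfolding below_top_def
proof (rule span_lower_stable[rotated 2])
  fix w assume "y \<in> h" "w \<in> {w. w \<noteq> [] \<and> set w \<subseteq> {..<n}}"
  moreover from this have "lower w \<in> V.span (lower ` {w. w \<noteq> [] \<and> set w \<subseteq> {..<n}})"
    by (intro V.span_base imageI) simp
  ultimately show "act y (lower w) \<in> V.span (lower ` {w. w \<noteq> [] \<and> set w \<subseteq> {..<n}})"
    by (auto simp: act_h_lower intro!: V.span_scale)
qed simp_all

text \<open>
  The vectors that no product of raising operators brings back to the top form a submodule: such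
  a product can be commuted past \<open>f j\<close>, and the image of \<open>f j\<close> lies below the top.
\<close>
lemma irreducible_nondegenerate:
  assumes irr: "irreducible_module"
    and x: "\<And>w. set w \<subseteq> {..<n} \<Longrightarrow> foldr (\<lambda>i. act (e i)) w x \<in> below_top"
  shows "x = 0"
proof -
  let ?E = "\<lambda>w. foldr (\<lambda>i. act (e i)) w"
  let ?R = "{x. \<forall>w. set w \<subseteq> {..<n} \<longrightarrow> ?E w x \<in> below_top}"
  have N: "V.subspace below_top" by (simp add: below_top_def)
  have lin: "?E w (y + z) = ?E w y + ?E w z" "?E w (vscale c y) = vscale c (?E w y)" "?E w 0 = 0"
    for w y z c
    by (induction w) (simp_all add: act_add act_vscale act_zero)
  have R: "V.subspace ?R"
    by (rule V.subspaceI)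
      (use N in \<open>auto simp: lin V.subspace_0 V.subspace_add V.subspace_scale\<close>)
  have e: "act (e i) y \<in> ?R" if "i < n" "y \<in> ?R" for i y
  proof (intro CollectI allI impI)
    fix w assume "set w \<subseteq> {..<n}"
    then have "?E (w @ [i]) y \<in> below_top"
      using that \<open>set w \<subseteq> {..<n}\<close> by (auto simp del: foldr_append)
    then show "?E w (act (e i) y) \<in> below_top" by simp
  qed
  have Eh: "\<exists>c. ?E w (act y z) = act y (?E w z) + vscale c (?E w z)" if "set w \<subseteq> {..<n}" "y \<in> h" for w y z
    using that(1)
  proof (induction w)
    case Nil
    have "?E [] (act y z) = act y (?E [] z) + vscale 0 (?E [] z)" by simp
    then show ?case by blast
  next
    case (Cons i w)
    then obtain c where c: "?E w (act y z) = act y (?E w z) + vscale c (?E w z)" by auto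
    have "?E (i # w) (act y z) = act y (?E (i # w) z) + vscale (c - root i y) (?E (i # w) z)"
      using Cons.prems that(2)
      by (simp add: c act_add act_vscale act_h_e V.scale_left_diff_distrib)
    then show ?case by blast
  qed
  have h: "act y z \<in> ?R" if yz: "y \<in> h" "z \<in> ?R" for y z
  proof (intro CollectI allI impI)
    fix w assume w: "set w \<subseteq> {..<n}"
    obtain c where c: "?E w (act y z) = act y (?E w z) + vscale c (?E w z)"
      using Eh[OF w yz(1)] by blast
    then show "?E w (act y z) \<in> below_top"
      unfolding c using yz w h_below_top N by (simp add: V.subspace_add V.subspace_scale)
  qed
  have Ef: "?E w (act (f j) z) \<in> below_top" if "j < n" "z \<in> ?R" "set w \<subseteq> {..<n}" for w j z
    using that
  proof (induction w arbitrary: z rule: rev_induct)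
    case Nil
    then show ?case by (simp add: f_below_top)
  next
    case (snoc i w)
    then have i: "i < n" and w: "set w \<subseteq> {..<n}" by auto
    have "?E w (act (f j) (act (e i) z)) \<in> below_top"
      using snoc.IH[OF snoc.prems(1) e[OF i snoc.prems(2)] w] .
    moreover have "?E w (if i = j then act (coroot i) z else 0) \<in> below_top"
      using h[OF coroot_in_h[OF i] snoc.prems(2)] w N by (auto simp: lin V.subspace_0)
    ultimately have "?E w (act (e i) (act (f j) z)) \<in> below_top"
      unfolding act_e_f[OF i snoc.prems(1)] lin using N by (rule V.subspace_add[rotated])
    then show ?case by simp
  qed
  have "submodule ?R"
    by (rule submoduleI[OF R]) (use h e Ef in blast)+
  moreover have "v \<notin> ?R"
    using v_not_below_top by (auto intro!: exI[of _ "[]"])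
  ultimately have "?R = {0}"
    using irr unfolding irreducible_module_def by blast
  then show ?thesis using x by blast
qed

end

section \<open>Comparison of the module with the Fock space\<close>

locale shuffle_weight =
  highest_weight_rep scale bracket p "affine_A p" h coroot root e f vscale act \<Lambda> v +
  grid: fock_grid k l s
  for scale :: "complex \<Rightarrow> 'g::ab_group_add \<Rightarrow> 'g"
    and bracket :: "'g \<Rightarrow> 'g \<Rightarrow> 'g"
    and p :: nat
    and h :: "'g set"
    and coroot :: "nat \<Rightarrow> 'g"
    and root :: "nat \<Rightarrow> 'g \<Rightarrow> complex"
    and e f :: "nat \<Rightarrow> 'g"
    and vscale :: "complex \<Rightarrow> 'v::ab_group_add \<Rightarrow> 'v"
    and act :: "'g \<Rightarrow> 'v \<Rightarrow> 'v"
    and \<Lambda> :: "'g \<Rightarrow> complex" and v :: 'v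
    and k l s :: nat +
  assumes l_pos: "1 \<le> l" and rows_le: "2 * l + s \<le> p"
    and irreducible: "irreducible_module"
    and \<Lambda>_coroot: "i < p \<Longrightarrow> \<Lambda> (coroot i) = of_nat k * of_bool (i = 0) + of_bool (i = s)"
begin

text \<open>
  The chain of vertices \<open>p - l + 1, ..., p - 1, 0, 1, ..., l + s - 1\<close>, numbered from \<open>0\<close>. The
  vertex \<open>node t\<close> acts on the Fock space by moving particles between the rows \<open>t\<close> and \<open>Suc t\<close>,
  so the vertex \<open>0\<close> sits at the end of the full rows and \<open>s\<close> at the end of the rows with a
  single particle.
\<close>
definition node :: "nat \<Rightarrow> nat" where
  "node t = (if Suc t < l then p - l + Suc t else Suc t - l)"

lemma node_less: "t < p \<Longrightarrow> node t < p"
  using l_pos rows_le by (auto simp: node_def)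

lemma node_inject: "t < p \<Longrightarrow> t' < p \<Longrightarrow> node t = node t' \<longleftrightarrow> t = t'"
  using l_pos rows_le by (auto simp: node_def split: if_splits)

lemma node_Suc: "Suc t < p \<Longrightarrow> (node t + 1) mod p = node (Suc t)"
  using l_pos rows_le by (auto simp: node_def mod_if)

lemma affine_A_node:
  assumes "Suc t < p" "Suc t' < p"
  shows "affine_A p (node t) (node t') =
    2 * of_bool (t = t') - of_bool (Suc t = t') - of_bool (Suc t' = t)"
  using assms by (simp add: affine_A_def node_Suc[simplified] node_inject)

lemma \<Lambda>_node:
  assumes "Suc t < grid.num_rows"
  shows "\<Lambda> (coroot (node t)) =
    of_int (grid.base_occ {..<s} t - grid.base_occ {..<s} (Suc t))"
proof -
  have "node t = 0 \<longleftrightarrow> Suc t = l" "node t = s \<longleftrightarrow> Suc t = l + s"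
    using l_pos rows_le assms by (auto simp: node_def)
  then show ?thesis
    using \<Lambda>_coroot[of "node t"] node_less[of t] assms rows_le l_pos
    by (auto simp: grid.base_occ_def grid.d_def not_less le_Suc_eq of_bool_def split: if_splits)
qed

text \<open>
  The submodule generated by the two highest weight vectors in the direct sum of the module and the
  Fock space, graded by row occupancies \<open>r\<close>. The rule \<open>zero\<close> provides the zero pair in every
  degree, which is needed because raising may leave the degrees reached from the top.
\<close>
inductive paired :: "(nat \<Rightarrow> int) \<Rightarrow> 'v \<Rightarrow> fock \<Rightarrow> bool" where
  top: "paired (grid.base_occ {..<s}) v (ket (grid.base {..<s}))"
| zero: "paired r 0 0"
| add: "paired r x y \<Longrightarrow> paired r x' y' \<Longrightarrow> paired r (x + x') (y + y')"
| scale: "paired r x y \<Longrightarrow> paired r (vscale c x) (fscale c y)"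
| lower: "paired r x y \<Longrightarrow> Suc t < grid.num_rows \<Longrightarrow>
    paired (\<lambda>i. r i + grid.shift (Suc t) t i) (act (f (node t)) x) (grid.E (Suc t) t y)"

lemma paired_diff: "paired r x y \<Longrightarrow> paired r x' y' \<Longrightarrow> paired r (x - x') (y - y')"
  using paired.add[OF _ paired.scale[of r x' y' "- 1"]] by (simp add: fscale_def fun_diff_def plus_fun_def)

lemma paired_sum:
  assumes "\<And>i. i \<in> I \<Longrightarrow> paired r (x i) (y i)"
  shows "paired r (\<Sum>i\<in>I. x i) (\<Sum>i\<in>I. y i)"
proof (cases "finite I")
  case True
  then show ?thesis
    using assms
  proof (induction I)
    case (insert i I)
    then show ?case
      unfolding sum.insert[OF insert.hyps] by (intro paired.add) auto
  qed (simp only: sum.empty paired.zero)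
next
  case False
  then show ?thesis by (simp only: sum.infinite[OF False] paired.zero)
qed

lemma node_h: "Suc t < grid.num_rows \<Longrightarrow> node t < p \<and> coroot (node t) \<in> h"
  using node_less rows_le coroot_in_h by simp

text \<open>
  The difference of neighbouring row occupancies plays the part of the weight on both sides, which
  is why the commutators of raising and lowering operators agree.
\<close>
lemma paired_coroot:
  assumes "paired r x y" and t: "Suc t < grid.num_rows"
  shows "act (coroot (node t)) x = vscale (of_int (r t - r (Suc t))) x"
  using assms(1)
proof induction
  case top
  show ?case using h_v node_h[OF t] \<Lambda>_node[OF t] by simp
next
  case (lower r x y t')
  have A: "root (node t') (coroot (node t)) = of_int (affine_A p (node t) (node t'))"
    using node_h t lower.hyps by (intro root_coroot) auto
  have "of_int (r t - r (Suc t)) - of_int (affine_A p (node t) (node t')) =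
      (of_int ((r t + grid.shift (Suc t') t' t) - (r (Suc t) + grid.shift (Suc t') t' (Suc t))) :: complex)"
    using t lower.hyps rows_le by (auto simp: affine_A_node grid.shift_def of_bool_def)
  then show ?case
    using node_h[OF t] node_h[OF lower.hyps(2)]
    by (simp only: act_h_f lower.IH act_vscale A flip: V.scale_left_diff_distrib)
qed (simp_all add: act_zero act_add act_vscale V.scale_right_distrib V.scale_left_commute)

lemma paired_row:
  assumes "paired r x y"
  shows "grid.E u u y = fscale (of_int (r u)) y"
  using assms
proof induction
  case top
  show ?case by (rule grid.E_diag_base)
next
  case (lower r x y t)
  have fs: "fscale (of_int (r u + grid.shift (Suc t) t u)) z = fscale (of_int (r u)) z +
      (if u = Suc t then z else 0) - (if u = t then z else 0)" for z
    by (auto simp: grid.shift_def fun_eq_iff fscale_def algebra_simps)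
  show ?case
    unfolding grid.E_commute[of u u "Suc t" t] lower.IH grid.E_linear fs
    by (cases "u = t"; cases "u = Suc t") simp_all
next
  case (zero r)
  show ?case by (simp only: grid.E_linear fock.scale_zero_right)
next
  case (add r x y x' y')
  then show ?case by (simp only: grid.E_linear fock.scale_right_distrib)
next
  case (scale r x y c)
  then show ?case by (simp only: grid.E_linear fock.scale_left_commute)
qed

lemma paired_raise:
  assumes "paired r x y" and t: "Suc t < grid.num_rows"
  shows "paired (\<lambda>i. r i + grid.shift t (Suc t) i) (act (e (node t)) x) (grid.E t (Suc t) y)"
  using assms(1)
proof induction
  case top
  have "grid.E t (Suc t) (ket (grid.base {..<s})) = 0"
    by (rule grid.E_raise_base) simp
  then show ?case
    using e_v node_h[OF t] by (simp only: paired.zero)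
next
  case (zero r)
  show ?case by (simp only: act_zero grid.E_linear paired.zero)
next
  case (add r x y x' y')
  then show ?case by (simp only: act_add grid.E_linear paired.add)
next
  case (scale r x y c)
  then show ?case by (simp only: act_vscale grid.E_linear paired.scale)
next
  case (lower r x y t')
  let ?r = "\<lambda>i. (r i + grid.shift (Suc t') t' i) + grid.shift t (Suc t) i"
  have "paired (\<lambda>i. (r i + grid.shift t (Suc t) i) + grid.shift (Suc t') t' i)
     (act (f (node t')) (act (e (node t)) x)) (grid.E (Suc t') t' (grid.E t (Suc t) y))"
    using lower.IH lower.hyps(2) by (rule paired.lower)
  then have first: "paired ?r
     (act (f (node t')) (act (e (node t)) x)) (grid.E (Suc t') t' (grid.E t (Suc t) y))"
    by (simp only: add.assoc add.commute[of "grid.shift t (Suc t) _"])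
  have ef: "act (e (node t)) (act (f (node t')) x) = act (f (node t')) (act (e (node t)) x) +
      (if t = t' then act (coroot (node t)) x else 0)"
    using node_h[OF t] node_h[OF lower.hyps(2)] node_inject[of t t'] t lower.hyps rows_le
    by (simp add: act_e_f)
  have EF: "grid.E t (Suc t) (grid.E (Suc t') t' y) = grid.E (Suc t') t' (grid.E t (Suc t) y) +
      (if t = t' then fscale (of_int (r t - r (Suc t))) y else 0)"
    unfolding grid.E_commute[of t "Suc t" "Suc t'" t']
    by (simp add: paired_row[OF lower.hyps(1)] fock.scale_left_diff_distrib)
  have "paired ?r (if t = t' then act (coroot (node t)) x else 0)
      (if t = t' then fscale (of_int (r t - r (Suc t))) y else 0)"
  proof (cases "t = t'")
    case True
    have "?r = r" using True by (simp add: grid.shift_def fun_eq_iff)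
    then show ?thesis
      using True paired.scale[OF lower.hyps(1)] paired_coroot[OF lower.hyps(1) t] by simp
  qed (simp only: if_False paired.zero)
  then show ?case
    unfolding ef EF using first by (rule paired.add[rotated])
qed

text \<open>
  Vertices off the chain commute with all lowering operators in use.
\<close>
lemma paired_other_e:
  assumes "paired r x y" and i: "i < p" "i \<notin> node ` {t. Suc t < grid.num_rows}"
  shows "act (e i) x = 0"
  using assms(1)
proof induction
  case top
  then show ?case using e_v i(1) by simp
next
  case (lower r x y t)
  then have "i \<noteq> node t" using i(2) by auto
  then show ?case
    using lower i(1) node_h[OF lower.hyps(2)] by (simp add: act_e_f act_zero)
qed (simp_all add: act_zero act_add act_vscale)

abbreviation num_modes :: nat where "num_modes \<equiv> grid.num_rows * grid.d"

lemma paired_supported: "paired r x y \<Longrightarrow> supported num_modes y"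
proof (induction rule: paired.induct)
  case top
  have "grid.base {..<s} \<subseteq> {..<num_modes}" by (rule grid.base_subset) auto
  then show ?case by (auto simp: supported_def ket_def)
next
  case (lower r x y t)
  then show ?case by (intro grid.supported_E) auto
qed (simp_all add: supported_def fscale_def)

abbreviation top_coeff :: "fock \<Rightarrow> complex" where
  "top_coeff y \<equiv> finner num_modes (ket (grid.base {..<s})) y"

lemma paired_top_coeff:
  assumes "paired r x y"
  shows "x - vscale (top_coeff y) v \<in> below_top"
  using assms
proof induction
  case top
  have "grid.base {..<s} \<subseteq> {..<num_modes}" by (rule grid.base_subset) auto
  moreover have "top_coeff (ket (grid.base {..<s})) =
      (\<Sum>S\<in>Pow {..<num_modes}. if S = grid.base {..<s} then 1 else 0)"
    unfolding finner_def ket_def by (rule sum.cong) auto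
  ultimately have "top_coeff (ket (grid.base {..<s})) = 1"
    by simp
  then show ?case by (simp add: below_top_def V.span_zero)
next
  case (zero r)
  show ?case
    by (simp add: below_top_def V.span_zero finner_linear del: zero_fun_apply)
next
  case (add r x y x' y')
  have "(x + x') - vscale (top_coeff (y + y')) v =
      (x - vscale (top_coeff y) v) + (x' - vscale (top_coeff y') v)"
    by (simp add: finner_linear V.scale_left_distrib)
  then show ?case
    using add.IH unfolding below_top_def by (simp only: V.span_add)
next
  case (scale r x y c)
  have "finner N z (fscale c y) = c * finner N z y" for N z
    by (simp add: finner_def fscale_def sum_distrib_left mult_ac)
  then have "vscale c x - vscale (top_coeff (fscale c y)) v = vscale c (x - vscale (top_coeff y) v)"
    by (simp add: V.scale_right_diff_distrib)
  then show ?case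
    using scale.IH unfolding below_top_def by (simp only: V.span_scale)
next
  case (lower r x y t)
  have "top_coeff (grid.E (Suc t) t y) = finner num_modes (grid.E t (Suc t) (ket (grid.base {..<s}))) y"
    using lower.hyps by (intro grid.finner_E[symmetric]) auto
  also have "grid.E t (Suc t) (ket (grid.base {..<s})) = 0"
    by (rule grid.E_raise_base) simp
  finally show ?case
    using f_below_top node_h[OF lower.hyps(2)] by (simp add: finner_linear del: zero_fun_apply)
qed

text \<open>
  By adjointness a vector paired with \<open>0\<close> is orthogonal to everything obtained by lowering, in
  particular to itself.
\<close>
lemma paired_zero_left:
  assumes "paired r 0 y"
  shows "y = 0"
proof -
  have "finner num_modes y' y = 0" if "paired r' x' y'" "paired r 0 y" for r' x' y' r y
    using that
  proof (induction arbitrary: r y)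
    case top
    have "0 - vscale (top_coeff y) v \<in> below_top"
      using paired_top_coeff[OF top] .
    then have c: "vscale (- top_coeff y) v \<in> below_top" by simp
    show ?case
    proof (rule ccontr)
      assume "top_coeff y \<noteq> 0"
      have "vscale (inverse (- top_coeff y)) (vscale (- top_coeff y) v) \<in> below_top"
        using c unfolding below_top_def by (rule V.span_scale)
      then show False
        using \<open>top_coeff y \<noteq> 0\<close> v_not_below_top by simp
    qed
  next
    case (lower r' x' y' t)
    have "paired (\<lambda>i. r i + grid.shift t (Suc t) i) (act (e (node t)) 0) (grid.E t (Suc t) y)"
      using lower.prems lower.hyps(2) by (rule paired_raise)
    then have "finner num_modes y' (grid.E t (Suc t) y) = 0"
      unfolding act_zero by (rule lower.IH)
    then show ?case
      using lower.hyps(2) by (subst grid.finner_E) auto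
  qed (simp_all add: finner_linear)
  then have "finner num_modes y y = 0"
    using assms by blast
  then show ?thesis
    using paired_supported[OF assms] by (rule finner_definite[rotated])
qed

text \<open>
  No product of raising operators brings \<open>x\<close> to the top: the result is still paired with \<open>0\<close>, or
  vanishes because a vertex off the chain is involved.
\<close>
lemma paired_zero_right:
  assumes "paired r x 0"
  shows "x = 0"
proof (rule irreducible_nondegenerate[OF irreducible])
  fix w assume "set w \<subseteq> {..<p}"
  then show "foldr (\<lambda>i. act (e i)) w x \<in> below_top"
    using assms
  proof (induction w arbitrary: r x rule: rev_induct)
    case Nil
    have "x - vscale (top_coeff 0) v \<in> below_top"
      by (rule paired_top_coeff) (rule Nil)
    then show ?case by (simp add: finner_linear(4))
  next
    case (snoc i w)
    show ?case
    proof (cases "i \<in> node ` {t. Suc t < grid.num_rows}")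
      case True
      then obtain t where t: "i = node t" "Suc t < grid.num_rows" by blast
      have "paired (\<lambda>i. r i + grid.shift t (Suc t) i) (act (e i) x) 0"
        using paired_raise[OF snoc.prems(2) t(2)] by (simp only: t(1) grid.E_linear)
      then have "foldr (\<lambda>i. act (e i)) w (act (e i) x) \<in> below_top"
        by (rule snoc.IH[rotated]) (use snoc.prems(1) in auto)
      then show ?thesis by simp
    next
      case False
      have "act (e i) x = 0"
        using paired_other_e[OF snoc.prems(2) _ False] snoc.prems(1) by simp
      moreover have "foldr (\<lambda>i. act (e i)) w 0 = 0"
        by (induction w) (simp_all add: act_zero)
      ultimately show ?thesis by (simp add: below_top_def V.span_zero)
    qed
  qed
qed

lemma occ_zeros:
  assumes "distinct zs"
  shows "grid.occ (map (\<lambda>q. (q, 0)) zs) = grid.base_occ (set zs)"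
proof -
  have snd: "map snd (map (\<lambda>q. (q, 0::nat)) zs) = replicate (length zs) 0"
    and fst: "map fst (map (\<lambda>q. (q, 0::nat)) zs) = zs"
    by (simp_all add: comp_def map_replicate_const)
  have "count (mset zs) q = of_bool (q \<in> set zs)" for q
    using assms by (simp add: distinct_count_atmost_1[THEN iffD1, rule_format])
  then show ?thesis
    unfolding grid.occ_def[abs_def] grid.base_occ_def[abs_def] snd fst by (auto simp: fun_eq_iff)
qed

lemma paired_in_span: "paired r x y \<Longrightarrow> y \<in> fock.span (grid.word_vec ` grid.words_of r s)"
proof (induction rule: paired.induct)
  case top
  let ?L = "map (\<lambda>q. (q, 0::nat)) [0..<s]"
  obtain g where g: "g \<noteq> 0" "grid.word_vec ?L = fscale g (ket (grid.base (set [0..<s])))"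
    using grid.word_vec_zeros[of "[0..<s]"] by auto
  have "{..<s} = set [0..<s]" by auto
  then have ket: "ket (grid.base {..<s}) = fscale (inverse g) (grid.word_vec ?L)"
    using g by (simp only: fock.scale_scale) simp
  have snd: "map snd ?L = replicate s 0"
    by (simp add: comp_def map_replicate_const)
  have "grid.occ ?L = grid.base_occ {..<s}"
    using occ_zeros[of "[0..<s]"] \<open>{..<s} = set [0..<s]\<close> by simp
  then have "?L \<in> grid.words_of (grid.base_occ {..<s}) s"
    unfolding grid.words_of_def mem_Collect_eq snd by simp
  then show ?case
    unfolding ket by (intro fock.span_scale fock.span_base imageI)
next
  case (zero r)
  show ?case by (rule fock.span_zero)
next
  case (add r x y x' y')
  then show ?case by (intro fock.span_add)
next
  case (scale r x y c)
  then show ?case by (intro fock.span_scale)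
next
  case (lower r x y t)
  let ?S = "fock.span (grid.word_vec ` grid.words_of (\<lambda>i. r i + grid.shift (Suc t) t i) s)"
  obtain T c where T: "finite T" "T \<subseteq> grid.word_vec ` grid.words_of r s" "y = (\<Sum>a\<in>T. fscale (c a) a)"
    using lower.IH unfolding fock.span_explicit by blast
  show ?case
    unfolding T(3) grid.E_sum grid.E_linear
  proof (intro fock.span_sum fock.span_scale)
    fix a assume "a \<in> T"
    then obtain L where "L \<in> grid.words_of r s" "a = grid.word_vec L"
      using T(2) by blast
    then show "grid.E (Suc t) t a \<in> ?S"
      using grid.word_vec_lower[OF l_pos] by blast
  qed
qed

lemma paired_target_in_span:
  assumes "paired grid.target_occ x y"
  shows "y \<in> fock.span (grid.shuffle_vec ` grid.avoiders)" (is "_ \<in> ?S")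
proof -
  have "grid.word_vec L \<in> ?S" if L: "L \<in> grid.words_of grid.target_occ s" for L
  proof -
    obtain g w where w: "w \<in> shuffles_of s l" "grid.word_vec L = fscale g (grid.shuffle_vec w)"
      using grid.word_vec_target[OF L] by blast
    show ?thesis
      unfolding w(2) by (intro fock.span_scale grid.shuffle_vec_in_span_avoiders w(1))
  qed
  then have "fock.span (grid.word_vec ` grid.words_of grid.target_occ s) \<subseteq> ?S"
    by (intro fock.span_minimal fock.subspace_span) auto
  then show ?thesis using paired_in_span[OF assms] by blast
qed

section \<open>Every shuffle is reached\<close>

text \<open>
  Beyond the first subdiagonal, \<open>E b a\<close> is an iterated commutator of lowering operators; the
  same commutator is taken in the module.
\<close>
lemma lift_E:
  assumes "a < b" "b < grid.num_rows"
  shows "\<exists>T. \<forall>r x y. paired r x y \<longrightarrow> paired (\<lambda>i. r i + grid.shift b a i) (T x) (grid.E b a y)"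
  using assms
proof (induction b)
  case 0
  then show ?case by simp
next
  case (Suc b)
  show ?case
  proof (cases "a = b")
    case True
    then show ?thesis
      using paired.lower[of _ _ _ b] Suc.prems by (intro exI[of _ "act (f (node b))"]) simp
  next
    case False
    then have "a < b" using Suc.prems by simp
    then obtain T where T: "\<And>r x y. paired r x y \<Longrightarrow>
        paired (\<lambda>i. r i + grid.shift b a i) (T x) (grid.E b a y)"
      using Suc by (meson Suc_lessD)
    let ?T = "\<lambda>x. act (f (node b)) (T x) - T (act (f (node b)) x)"
    have "paired (\<lambda>i. r i + grid.shift (Suc b) a i) (?T x) (grid.E (Suc b) a y)"
      if xy: "paired r x y" for r x y
    proof -
      have occ: "(\<lambda>i. (r i + grid.shift b a i) + grid.shift (Suc b) b i) = (\<lambda>i. r i + grid.shift (Suc b) a i)"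
        "(\<lambda>i. (r i + grid.shift (Suc b) b i) + grid.shift b a i) = (\<lambda>i. r i + grid.shift (Suc b) a i)"
        by (auto simp: fun_eq_iff grid.shift_def)
      have "grid.E (Suc b) a y = grid.E (Suc b) b (grid.E b a y) - grid.E b a (grid.E (Suc b) b y)"
        unfolding grid.E_commute[of "Suc b" b b a] using \<open>a < b\<close> by simp
      then show ?thesis
        using paired_diff[OF paired.lower[OF T[OF xy] Suc.prems(2), unfolded occ]
            T[OF paired.lower[OF xy Suc.prems(2)], unfolded occ]] by simp
    qed
    then show ?thesis by (intro exI[of _ ?T]) blast
  qed
qed

text \<open>
  Starting from the positions \<open>{..<s}\<close>, particles in column \<open>0\<close> are moved one position at a time; the
  sum of the positions decreases in the reverse direction.
\<close>
lemma reach_base: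
  assumes "Z \<subseteq> {..<l + s}" "card Z = s"
  shows "\<exists>x. paired (grid.base_occ Z) x (ket (grid.base Z))"
  using assms
proof (induction "\<Sum>Z" arbitrary: Z rule: less_induct)
  case less
  have fin: "finite Z" using less.prems(1) finite_subset by blast
  show ?case
  proof (cases "\<exists>q. Suc q \<in> Z \<and> q \<notin> Z")
    case True
    then obtain q where q: "Suc q \<in> Z" "q \<notin> Z" by blast
    \<comment> \<open>Moving the particle at \<open>q\<close> of \<open>?Y\<close> one position down gives \<open>Z\<close>.\<close>
    let ?Y = "insert q (Z - {Suc q})"
    have "\<Sum>Z = Suc q + \<Sum>(Z - {Suc q})"
      by (rule sum.remove[OF fin q(1)])
    moreover have "\<Sum>?Y = q + \<Sum>(Z - {Suc q})"
      using fin q(2) by (intro sum.insert) auto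
    ultimately have "\<Sum>?Y < \<Sum>Z" by linarith
    moreover have "?Y \<subseteq> {..<l + s}" using less.prems(1) q(1) by auto
    moreover have "card ?Y = s"
      using card.remove[OF fin q(1)] fin q(2) less.prems(2) by simp
    ultimately obtain x where x: "paired (grid.base_occ ?Y) x (ket (grid.base ?Y))"
      using less.hyps by blast
    have Z: "insert (Suc q) (?Y - {q}) = Z" using q by auto
    obtain g where g: "g \<noteq> 0"
      "grid.E (Suc (l + q)) (l + q) (ket (grid.base ?Y)) = fscale g (ket (grid.base Z))"
      using grid.E_lower_base[of q ?Y] q unfolding Z by auto
    have "Suc (l + q) < grid.num_rows" using q(1) less.prems(1) by auto
    then have "paired (\<lambda>i. grid.base_occ ?Y i + grid.shift (Suc (l + q)) (l + q) i)
        (act (f (node (l + q))) x) (fscale g (ket (grid.base Z)))"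
      using paired.lower[OF x, of "l + q"] g(2) by simp
    also have "(\<lambda>i. grid.base_occ ?Y i + grid.shift (Suc (l + q)) (l + q) i) = grid.base_occ Z"
    proof
      fix i
      show "grid.base_occ ?Y i + grid.shift (Suc (l + q)) (l + q) i = grid.base_occ Z i"
      proof (cases "i < l")
        case False
        then obtain j where "i = l + j" using le_Suc_ex by (metis not_less)
        then show ?thesis using q by (auto simp: grid.base_occ_def grid.shift_def)
      qed (simp add: grid.base_occ_def grid.shift_def)
    qed
    finally have "paired (grid.base_occ Z) (vscale (inverse g) (act (f (node (l + q))) x))
        (fscale (inverse g) (fscale g (ket (grid.base Z))))"
      by (rule paired.scale)
    then show ?thesis using g(1) by auto
  next
    case False
    have down: "q \<in> Z" if "q + j \<in> Z" for q j
      using that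
    proof (induction j)
      case (Suc j)
      then show ?case using False by auto
    qed simp
    have "Z \<subseteq> {..<s}"
    proof
      fix q assume "q \<in> Z"
      then have "{..q} \<subseteq> Z" using down le_Suc_ex by (metis atMost_iff subsetI)
      then have "card {..q} \<le> s" using card_mono[OF fin] less.prems(2) by metis
      then show "q \<in> {..<s}" by simp
    qed
    then have "Z = {..<s}"
      using less.prems(2) by (intro card_subset_eq) auto
    then show ?thesis using paired.top by blast
  qed
qed

text \<open>
  The letters \<open>0\<close> cannot be carried out by elements of \<open>gl n\<close>, as they create particles. They are
  therefore applied first, all together.
\<close>
lemma reach_word:
  assumes zs: "distinct zs" "set zs \<subseteq> {..<l + s}" "length zs = s"
    and M: "\<forall>(q, x)\<in>set M. q < l + s \<and> 1 \<le> x \<and> x \<le> l"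
  shows "\<exists>x. paired (grid.occ (M @ map (\<lambda>q. (q, 0)) zs)) x (grid.word_vec (M @ map (\<lambda>q. (q, 0)) zs))"
  using M
proof (induction M)
  case Nil
  let ?L = "map (\<lambda>q. (q, 0::nat)) zs"
  obtain g where g: "grid.word_vec ?L = fscale g (ket (grid.base (set zs)))"
    using grid.word_vec_zeros[OF zs(1)] by auto
  obtain x where "paired (grid.base_occ (set zs)) x (ket (grid.base (set zs)))"
    using reach_base[of "set zs"] zs distinct_card[OF zs(1)] by auto
  then have "paired (grid.base_occ (set zs)) (vscale g x) (grid.word_vec ?L)"
    unfolding g by (rule paired.scale)
  moreover have "grid.base_occ (set zs) = grid.occ ?L"
    by (rule occ_zeros[OF zs(1), symmetric])
  ultimately show ?case by auto
next
  case (Cons a M)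
  obtain q x where a: "a = (q, x)" by (cases a)
  let ?L = "M @ map (\<lambda>q. (q, 0)) zs"
  obtain u where u: "paired (grid.occ ?L) u (grid.word_vec ?L)"
    using Cons by auto
  have qx: "q < l + s" "1 \<le> x" "x \<le> l" using Cons.prems by (auto simp: a)
  then have "x - 1 < l + q" "l + q < grid.num_rows" by auto
  from lift_E[OF this] obtain T where "\<forall>r x' y. paired r x' y \<longrightarrow>
      paired (\<lambda>i. r i + grid.shift (l + q) (x - 1) i) (T x') (grid.E (l + q) (x - 1) y)"
    by blast
  with u have "paired (\<lambda>i. grid.occ ?L i + grid.shift (l + q) (x - 1) i) (T u)
      (grid.E (l + q) (x - 1) (grid.word_vec ?L))"
    by blast
  moreover have "grid.E (l + q) (x - 1) (grid.word_vec ?L) = grid.word_vec (a # ?L)"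
    using qx by (simp add: grid.word_vec_def grid.letter_op_def a)
  moreover have "(\<lambda>i. grid.occ ?L i + grid.shift (l + q) (x - 1) i) = grid.occ (a # ?L)"
    using qx by (auto simp: fun_eq_iff grid.occ_Cons grid.shift_def a)
  ultimately show ?case by auto
qed

lemma reach_shuffle:
  assumes w: "w \<in> shuffles_of s l"
  shows "\<exists>x. paired grid.target_occ x (grid.shuffle_vec w)"
proof -
  note props = grid.shuffle_props[OF w]
  define L where "L = zip [0..<l + s] w"
  define M where "M = filter (\<lambda>a. snd a \<noteq> 0) L"
  define zs where "zs = map fst (filter (\<lambda>a. snd a = 0) L)"
  have fst: "map fst L = [0..<l + s]" and snd: "map snd L = w"
    using props(1) by (simp_all add: L_def)
  have zs_eq: "map (\<lambda>q. (q, 0)) zs = filter (\<lambda>a. snd a = 0) L"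
    unfolding zs_def map_map by (rule map_idI) auto
  let ?L = "M @ map (\<lambda>q. (q, 0)) zs"
  have mset: "mset ?L = mset L"
    unfolding zs_eq by (simp add: M_def)
  have dist: "distinct (map fst L)" unfolding fst by simp
  have "\<exists>x. paired (grid.occ ?L) x (grid.word_vec ?L)"
  proof (rule reach_word)
    show "distinct zs"
      unfolding zs_def using dist by (rule distinct_map_filter)
    show "set zs \<subseteq> {..<l + s}"
      unfolding zs_def L_def by (auto dest: set_zip_leftD)
    have "length (filter (\<lambda>a. snd a = 0) K) = count (mset (map snd K)) 0" for K :: "(nat \<times> nat) list"
      by (induction K) auto
    then have "length zs = count (mset (map snd L)) 0"
      by (simp only: zs_def length_map)
    then show "length zs = s" using props(5) snd by simp
    show "\<forall>(q, x)\<in>set M. q < l + s \<and> 1 \<le> x \<and> x \<le> l"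
    proof (intro ballI, clarify)
      fix q x assume "(q, x) \<in> set M"
      then have qx: "(q, x) \<in> set L" and "x \<noteq> 0" by (auto simp: M_def)
      have "q \<in> set [0..<l + s]" "x \<in> set w"
        using set_zip_leftD[OF qx[unfolded L_def]] set_zip_rightD[OF qx[unfolded L_def]] .
      then show "q < l + s \<and> 1 \<le> x \<and> x \<le> l"
        using props(3)[of x] \<open>x \<noteq> 0\<close> by simp
    qed
  qed
  then obtain x where x: "paired (grid.occ ?L) x (grid.word_vec ?L)" by blast
  have map_mset: "mset (map h ?L) = mset (map h L)" for h :: "nat \<times> nat \<Rightarrow> nat"
    using mset by (metis mset_map)
  have "grid.occ ?L = grid.occ L"
    unfolding grid.occ_def[abs_def] map_mset ..
  then have occ: "grid.occ ?L = grid.target_occ"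
    unfolding L_def grid.occ_shuffle[OF w] .
  have "\<exists>g. g \<noteq> 0 \<and> grid.word_vec ?L = fscale g (grid.conf_sum (set ?L))"
  proof (rule grid.word_vec_eq_conf_sum)
    show "distinct (map fst ?L)"
      using dist mset_eq_imp_distinct_iff[OF map_mset] by blast
    have "mset (filter (\<lambda>x. x \<noteq> 0) (map snd ?L)) = mset (filter (\<lambda>x. x \<noteq> 0) w)"
      using map_mset[of snd] snd by (metis mset_filter)
    then show "distinct (filter (\<lambda>x. x \<noteq> 0) (map snd ?L))"
      using props(4) mset_eq_imp_distinct_iff by blast
    have "snd ` set ?L = set w"
      using map_mset[of snd] snd by (metis set_map set_mset_mset)
    then show "\<forall>x\<in>snd ` set ?L. x \<le> l" using props(3) by blast
  qed
  moreover have "set ?L = set L" using mset by (metis set_mset_mset)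
  ultimately obtain g where g: "g \<noteq> 0" "grid.word_vec ?L = fscale g (grid.shuffle_vec w)"
    using grid.shuffle_vec_eq[OF w] unfolding L_def by auto
  have "paired grid.target_occ (vscale (inverse g) x) (fscale (inverse g) (fscale g (grid.shuffle_vec w)))"
    using paired.scale[OF x] unfolding occ g(2) .
  then show ?thesis using g(1) by auto
qed

section \<open>The weight space\<close>

text \<open>
  The coefficient of the simple root at \<open>node t\<close> in \<open>lambda_elt\<close>.
\<close>
definition mult :: "nat \<Rightarrow> nat" where
  "mult t = (if t < l then Suc t else if t < l + s then l else grid.num_rows - 1 - t)"

lemma target_occ_eq:
  "grid.target_occ i = grid.base_occ {..<s} i +
    (case i of 0 \<Rightarrow> 0 | Suc j \<Rightarrow> int (mult j)) - int (mult i)"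
  using l_pos
  by (auto simp: grid.target_occ_def grid.base_occ_def mult_def grid.d_def of_nat_diff split: nat.split)

lemma paired_lower:
  assumes "set u \<subseteq> {t. Suc t < grid.num_rows}"
  shows "\<exists>y. paired (\<lambda>i. grid.base_occ {..<s} i +
      (case i of 0 \<Rightarrow> 0 | Suc j \<Rightarrow> int (count (mset u) j)) - int (count (mset u) i))
    (lower (map node u)) y"
  using assms
proof (induction u)
  case Nil
  have "(\<lambda>i. grid.base_occ {..<s} i + (case i of 0 \<Rightarrow> 0 | Suc j \<Rightarrow> int (count (mset []) j)) -
      int (count (mset []) i)) = grid.base_occ {..<s}"
    by (auto simp: fun_eq_iff split: nat.split)
  then show ?case using paired.top by (auto simp: lower_Nil)
next
  case (Cons t u)
  let ?r = "\<lambda>u i. grid.base_occ {..<s} i +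
      (case i of 0 \<Rightarrow> 0 | Suc j \<Rightarrow> int (count (mset u) j)) - int (count (mset u) i)"
  obtain y where "paired (?r u) (lower (map node u)) y"
    using Cons by auto
  then have "paired (\<lambda>i. ?r u i + grid.shift (Suc t) t i) (act (f (node t)) (lower (map node u)))
      (grid.E (Suc t) t y)"
    using Cons.prems by (intro paired.lower) auto
  moreover have "(\<lambda>i. ?r u i + grid.shift (Suc t) t i) = ?r (t # u)"
    by (auto simp: fun_eq_iff grid.shift_def split: nat.split)
  ultimately show ?case by (auto simp: lower_Cons)
qed

text \<open>
  The number of particles that have passed from row \<open>t\<close> to row \<open>Suc t\<close>, which is how often the
  vertex \<open>node t\<close> has been used for lowering.
\<close>
definition depth :: "(nat \<Rightarrow> int) \<Rightarrow> nat \<Rightarrow> int" where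
  "depth r t = (\<Sum>u\<le>t. grid.base_occ {..<s} u - r u)"

lemma depth_target: "depth grid.target_occ t = int (mult t)"
  by (induction t) (simp_all add: depth_def target_occ_eq)

lemma paired_weight:
  assumes "paired r x y" and z: "z \<in> h"
  shows "act z x = vscale (\<Lambda> z - (\<Sum>t<grid.num_rows - 1. of_int (depth r t) * root (node t) z)) x"
  using assms(1)
proof induction
  case top
  show ?case by (simp add: depth_def h_v z)
next
  case (lower r x y t')
  have "depth (\<lambda>i. r i + grid.shift (Suc t') t' i) t = depth r t + of_bool (t = t')" for t
  proof -
    have "(\<Sum>u\<le>t. grid.shift (Suc t') t' u) = - of_bool (t = t')"
      unfolding grid.shift_def sum_subtractf by (auto simp: of_bool_def sum.delta)
    then show ?thesis
      by (simp add: depth_def sum_subtractf sum.distrib)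
  qed
  then have "(\<Sum>t<grid.num_rows - 1. of_int (depth (\<lambda>i. r i + grid.shift (Suc t') t' i) t) * root (node t) z) =
      (\<Sum>t<grid.num_rows - 1. of_int (depth r t) * root (node t) z + (if t = t' then root (node t') z else 0))"
    by (intro sum.cong) (auto simp: algebra_simps)
  also have "\<dots> = (\<Sum>t<grid.num_rows - 1. of_int (depth r t) * root (node t) z) + root (node t') z"
    using lower.hyps(2) by (simp add: sum.distrib)
  finally show ?case
    using node_h[OF lower.hyps(2)] z
    by (simp add: act_h_f lower.IH act_vscale diff_diff_add flip: V.scale_left_diff_distrib)
qed (simp_all add: act_zero act_add act_vscale V.scale_right_distrib V.scale_left_commute)

lemma lambda_elt_eq:
  "lambda_elt p l s root z = (\<Sum>t<grid.num_rows - 1. of_nat (mult t) * root (node t) z)"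
proof -
  let ?g = "\<lambda>t. of_nat (mult t) * root (node t) z"
  have "{..<grid.num_rows - 1} = {..<l - 1} \<union> {l - 1} \<union> {l..<l + s} \<union> {l + s..<grid.num_rows - 1}"
    using l_pos by auto
  then have "(\<Sum>t<grid.num_rows - 1. ?g t) =
      (\<Sum>t<l - 1. ?g t) + ?g (l - 1) + (\<Sum>t=l..<l + s. ?g t) + (\<Sum>t=l + s..<grid.num_rows - 1. ?g t)"
    using l_pos by (simp only:) (subst sum.union_disjoint; (force | simp))+
  moreover have "?g (l - 1) = of_nat l * root 0 z"
    using l_pos by (simp add: mult_def node_def)
  moreover have "(\<Sum>t<l - 1. ?g t) = (\<Sum>j = 1..<l. of_nat (l - j) * root (p - j) z)"
    using l_pos rows_le
    by (intro sum.reindex_bij_witness[of _ "\<lambda>j. l - 1 - j" "\<lambda>t. l - 1 - t"])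
      (auto simp: mult_def node_def Suc_diff_Suc Suc_diff_le)
  moreover have "(\<Sum>t=l..<l + s. ?g t) = (\<Sum>i = 1..s. of_nat l * root i z)"
    using l_pos
    by (intro sum.reindex_bij_witness[of _ "\<lambda>i. l - 1 + i" "\<lambda>t. Suc t - l"])
      (auto simp: mult_def node_def)
  moreover have "(\<Sum>t=l + s..<grid.num_rows - 1. ?g t) = (\<Sum>j = 1..<l. of_nat (l - j) * root (s + j) z)"
    using l_pos
    by (intro sum.reindex_bij_witness[of _ "\<lambda>j. l + s + j - 1" "\<lambda>t. Suc t - (l + s)"])
      (auto simp: mult_def node_def)
  ultimately show ?thesis
    by (simp add: lambda_elt_def)
qed

lemma sum_count_eq:
  fixes g :: "nat \<Rightarrow> complex"
  assumes "set_mset m \<subseteq> {..<N}"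
  shows "(\<Sum>i<N. of_nat (count m i) * g i) = (\<Sum>i\<in>#m. g i)"
  using assms
proof (induction m)
  case (add x m)
  have "(\<Sum>i<N. of_nat (count (add_mset x m) i) * g i) =
      (\<Sum>i<N. of_nat (count m i) * g i + (if i = x then g x else 0))"
    by (intro sum.cong) (auto simp: algebra_simps)
  then show ?case
    using add by (simp add: sum.distrib)
qed simp

text \<open>
  A vector of this weight is a combination of lowered vectors whose content is exactly \<open>mult\<close>.
  In particular all of its letters lie on the chain, so each of them is paired.
\<close>
lemma weight_space_paired:
  "weight_space (\<lambda>z. \<Lambda> z - lambda_elt p l s root z) = {x. \<exists>y. paired grid.target_occ x y}"
proof
  show "{x. \<exists>y. paired grid.target_occ x y} \<subseteq> weight_space (\<lambda>z. \<Lambda> z - lambda_elt p l s root z)"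
    using paired_weight by (auto simp: weight_space_def lambda_elt_eq depth_target)
next
  let ?N = "grid.num_rows - 1"
  define M where "M = (\<Sum>t<?N. replicate_mset (mult t) t)"
  have count: "count M t = (if t < ?N then mult t else 0)" for t
    by (simp add: M_def count_sum)
  have M_sub: "set_mset M \<subseteq> {..<?N}"
    using count by (metis (no_types, lifting) count_eq_zero_iff lessThan_iff subsetI)
  let ?m = "image_mset node M"
  have m_sub: "set_mset ?m \<subseteq> {..<p}"
    using M_sub node_less rows_le by fastforce
  have "wt ?m = (\<lambda>z. \<Lambda> z - lambda_elt p l s root z)"
  proof
    fix z
    have "(\<Sum>i<p. of_nat (count ?m i) * root i z) = (\<Sum>i\<in>#?m. root i z)"
      by (rule sum_count_eq[OF m_sub])
    also have "\<dots> = (\<Sum>t\<in>#M. root (node t) z)"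
      by (simp add: image_mset.compositionality comp_def)
    also have "\<dots> = (\<Sum>t<?N. of_nat (count M t) * root (node t) z)"
      by (rule sum_count_eq[OF M_sub, symmetric])
    finally show "wt ?m z = \<Lambda> z - lambda_elt p l s root z"
      by (simp add: wt_def lambda_elt_eq count)
  qed
  then have "weight_space (\<lambda>z. \<Lambda> z - lambda_elt p l s root z) = V.span (lower ` {w. mset w = ?m})"
    using weight_space_eq_span[OF m_sub] by simp
  also have "\<dots> \<subseteq> {x. \<exists>y. paired grid.target_occ x y}"
  proof (rule V.span_minimal)
    show "lower ` {w. mset w = ?m} \<subseteq> {x. \<exists>y. paired grid.target_occ x y}"
    proof clarify
      fix w assume w: "mset w = ?m"
      obtain u0 where u0: "mset u0 = M" using ex_mset by blast
      then have "mset w = mset (map node u0)" using w by simp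
      then obtain \<pi> where \<pi>: "\<pi> permutes {..<length (map node u0)}" "permute_list \<pi> (map node u0) = w"
        by (rule mset_eq_permutation)
      define u where "u = permute_list \<pi> u0"
      have "w = map node u" and u: "mset u = M"
        using \<pi> u0 by (simp_all add: u_def permute_list_map)
      have "set u \<subseteq> {t. Suc t < grid.num_rows}"
        using M_sub u by (auto simp flip: set_mset_mset)
      moreover have "mult t = 0" if "\<not> t < ?N" for t
        using that l_pos by (auto simp: mult_def)
      then have "int (count (mset u) t) = int (mult t)" for t
        by (simp add: u count)
      then have "(\<lambda>i. grid.base_occ {..<s} i +
          (case i of 0 \<Rightarrow> 0 | Suc j \<Rightarrow> int (count (mset u) j)) - int (count (mset u) i)) = grid.target_occ"
        by (intro ext) (simp only: target_occ_eq split: nat.split)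
      ultimately have "\<exists>y. paired grid.target_occ (lower (map node u)) y"
        using paired_lower[of u] by metis
      then show "\<exists>y. paired grid.target_occ (lower w) y"
        using \<open>w = map node u\<close> by simp
    qed
    show "V.subspace {x. \<exists>y. paired grid.target_occ x y}"
      by (rule V.subspaceI) (auto intro: paired.zero paired.add paired.scale)
  qed
  finally show "weight_space (\<lambda>z. \<Lambda> z - lambda_elt p l s root z) \<subseteq> {x. \<exists>y. paired grid.target_occ x y}" .
qed

lemma multiplicity_shuffle_weight:
  "multiplicity (\<lambda>z. \<Lambda> z - lambda_elt p l s root z) = card grid.avoiders"
proof -
  let ?W = "{x. \<exists>y. paired grid.target_occ x y}"
  have fin: "finite grid.avoiders" using grid.finite_shuffles by simp
  obtain X where X: "\<And>w. w \<in> grid.avoiders \<Longrightarrow> paired grid.target_occ (X w) (grid.shuffle_vec w)"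
    using reach_shuffle by (metis (no_types, lifting) mem_Collect_eq)
  have comb: "paired grid.target_occ (\<Sum>w\<in>grid.avoiders. vscale (c w) (X w))
      (\<Sum>w\<in>grid.avoiders. fscale (c w) (grid.shuffle_vec w))" for c
    by (intro paired_sum paired.scale X)
  have indep: "c w = 0" if "(\<Sum>w\<in>grid.avoiders. vscale (c w) (X w)) = 0" "w \<in> grid.avoiders" for c w
  proof -
    have "(\<Sum>w\<in>grid.avoiders. fscale (c w) (grid.shuffle_vec w)) = 0"
      using comb[of c] unfolding that(1) by (rule paired_zero_left)
    then show ?thesis using that(2) by (rule grid.avoiders_independent)
  qed
  have inj: "inj_on X grid.avoiders"
    by (rule V.independent_image(1)[OF fin]) (rule indep)
  have ind: "V.independent (X ` grid.avoiders)"
    by (rule V.independent_image(2)[OF fin]) (rule indep)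
  have "V.dim ?W = card grid.avoiders"
  proof (rule V.dim_unique)
    show "X ` grid.avoiders \<subseteq> ?W" using X by blast
    show "?W \<subseteq> V.span (X ` grid.avoiders)"
    proof clarify
      fix x y assume xy: "paired grid.target_occ x y"
      obtain c where c: "y = (\<Sum>w\<in>grid.avoiders. fscale (c w) (grid.shuffle_vec w))"
        using fock.in_span_image_finite[OF fin paired_target_in_span[OF xy]] by blast
      have "paired grid.target_occ (x - (\<Sum>w\<in>grid.avoiders. vscale (c w) (X w))) (y - y)"
        using paired_diff[OF xy comb[of c]] unfolding c .
      then have "x - (\<Sum>w\<in>grid.avoiders. vscale (c w) (X w)) = 0"
        unfolding diff_self by (rule paired_zero_right)
      then have "x = (\<Sum>w\<in>grid.avoiders. vscale (c w) (X w))" by simp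
      also have "\<dots> \<in> V.span (X ` grid.avoiders)"
        by (intro V.span_sum V.span_scale V.span_base imageI)
      finally show "x \<in> V.span (X ` grid.avoiders)" .
    qed
    show "V.independent (X ` grid.avoiders)" by (rule ind)
    show "card (X ` grid.avoiders) = card grid.avoiders" using inj by (rule card_image)
  qed
  then show ?thesis
    unfolding multiplicity_def weight_space_paired .
qed

end

theorem theorem1p6:
  fixes p k s l :: nat
    and scale :: "complex \<Rightarrow> 'g::ab_group_add \<Rightarrow> 'g"
    and bracket :: "'g \<Rightarrow> 'g \<Rightarrow> 'g"
    and h :: "'g set"
    and coroot :: "nat \<Rightarrow> 'g"
    and \<alpha> \<omega> :: "nat \<Rightarrow> 'g \<Rightarrow> complex"
    and e f :: "nat \<Rightarrow> 'g"
    and \<Lambda> :: "'g \<Rightarrow> complex"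
    and vscale :: "complex \<Rightarrow> 'v::ab_group_add \<Rightarrow> 'v"
    and act :: "'g \<Rightarrow> 'v \<Rightarrow> 'v"
  assumes "p \<ge> 2" and "k \<ge> 1" and "s < p"
    and "kac_moody_module scale bracket p (affine_A p) h coroot \<alpha> e f vscale act"
    and "kac_moody_algebra.fundamental_weights scale p h coroot \<omega>"
    and "\<Lambda> = (\<lambda>x. of_nat k * \<omega> 0 x + \<omega> s x)"
    and "kac_moody_module.is_integrable_irreducible_hw scale bracket p h e f vscale act \<Lambda>"
    and "1 \<le> l" and "l \<le> (p - s) div 2"
  shows "kac_moody_module.multiplicity h vscale act (\<lambda>x. \<Lambda> x - lambda_elt p l s \<alpha> x)
         = card {w \<in> shuffles_of s l. \<not> has_decreasing_subseq (k + 2) w}"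
proof -
  interpret M: kac_moody_module scale bracket p "affine_A p" h coroot \<alpha> e f vscale act
    by (rule assms(4))
  have irr: "M.irreducible_module" and hw: "M.highest_weight_module \<Lambda>"
    using assms(7) by (auto simp: M.is_integrable_irreducible_hw_def)
  obtain v where v: "v \<noteq> 0" "\<forall>x\<in>M.n_plus. act x v = 0" "v \<in> M.weight_space \<Lambda>"
    "M.submodule hull {v} = UNIV"
    using hw unfolding M.highest_weight_module_def by blast
  have \<omega>: "\<omega> i (coroot j) = (if i = j then 1 else 0)" if "i < p" "j < p" for i j
    using assms(5) that unfolding M.fundamental_weights_def by blast
  interpret shuffle_weight scale bracket p h coroot \<alpha> e f vscale act \<Lambda> v k l s
  proof unfold_locales
    show "2 * l + s \<le> p" using assms(3,9) by linarith
    show "\<Lambda> (coroot i) = of_nat k * of_bool (i = 0) + of_bool (i = s)" if "i < p" for i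
      using \<omega>[OF _ that, of 0] \<omega>[OF assms(3) that] assms(1) by (auto simp: assms(6))
  qed (use v irr assms(8) in auto)
  show ?thesis by (rule multiplicity_shuffle_weight)
qed

end
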